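(* Let $K$ be a field and $\mathcal{G}$ a Hausdorff ample groupoid for which the Steinberg algebra $A_K(\mathcal{G})$ is simple. Then the following holds: (1) If $\mathcal{G}^{(0)}$ is not compact, then $[A_K(\mathcal{G}), A_K(\mathcal{G})]$ is a simple Lie $K$-algebra. (2) If $\mathcal{G}^{(0)}$ is compact and $A_K(\mathcal{G})$ is nontrivial, then $[A_K(\mathcal{G}), A_K(\mathcal{G})]$ is a simple Lie $K$-algebra if and only if $1_{\mathcal{G}^{(0)}}\notin [A_K(\mathcal{G}), A_K(\mathcal{G})]$.
   Context: A groupoid is a small category in which every morphism is invertible; for $x\in\mathcal{G}$, $s(x)=x^{-1}x$ and $r(x)=xx^{-1}$, the product $xy$ is defined iff $s(x)=r(y)$, and $\mathcal{G}^{(0)}=s(\mathcal{G})=r(\mathcal{G})$ is the unit space. A topological groupoid is a groupoid with a topology making inversion and composition continuous. It is étale if $\mathcal{G}^{(0)}$ is locally compact Hausdorff and $s$ is a local homeomorphism. An open bisection is an open set $U\subseteq\mathcal{G}$ such that $s|_U$ and $r|_U$ are homeomorphisms onto open subsets of $\mathcal{G}^{(0)}$. An étale groupoid is ample if its topology has a base of compact open bisections; it is Hausdorff if its topology is Hausdorff. For a field $K$ and a Hausdorff ample groupoid $\mathcal{G}$, the Steinberg algebra $A_K(\mathcal{G})$ is the $K$-span of the characteristic functions $1_U:\mathcal{G}\to K$ of compact open bisections $U$; equivalently $A_K(\mathcal{G})=C_c(\mathcal{G},K)$, the space of compactly supported continuous functions $\mathcal{G}\to K$ with $K$ discrete. Addition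 is pointwise and multiplication is convolution $(f\ast g)(\gamma)=\sum_{\gamma=\alpha\beta}f(\alpha)g(\beta)$. $1_{\mathcal{G}^{(0)}}$ denotes the characteristic function of $\mathcal{G}^{(0)}$ on $\mathcal{G}$. A simple Steinberg algebra $A_K(\mathcal{G})$ is called nontrivial if $A_K(\mathcal{G})\not\cong K$. For an associative $K$-algebra $R$ (not necessarily unital), $[R,R]$ is the $K$-span of all commutators $[x,y]=xy-yx$, $x,y\in R$; it is a Lie $K$-algebra under $[x,y]=xy-yx$. A Lie $K$-algebra $L$ is simple if $[L,L]\neq 0$ and its only Lie ideals ($K$-subspaces $I$ with $[L,I]\subseteq I$) are $0$ and $L$. *)

theory Defs
  imports "HOL-Analysis.Analysis" "HOL-Library.Function_Algebras"
begin

section \<open>Topological groupoids\<close>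

text \<open>
  A groupoid is given by its set of arrows, which is the underlying set of the topology; units are
  identified with identity arrows. The multiplication is a total function whose value on \<open>x, y\<close> is
  meaningful only if both are arrows and the source of \<open>x\<close> is the range of \<open>y\<close>.
\<close>

record 'g top_groupoid =
  gtop :: "'g topology"
  gmul :: "'g \<Rightarrow> 'g \<Rightarrow> 'g"
  ginv :: "'g \<Rightarrow> 'g"

definition arrows :: "'g top_groupoid \<Rightarrow> 'g set" where
  "arrows G = topspace (gtop G)"

definition gsrc :: "'g top_groupoid \<Rightarrow> 'g \<Rightarrow> 'g" where
  "gsrc G x = gmul G (ginv G x) x"

definition grng :: "'g top_groupoid \<Rightarrow> 'g \<Rightarrow> 'g" where
  "grng G x = gmul G x (ginv G x)"

definition composable :: "'g top_groupoid \<Rightarrow> ('g \<times> 'g) set" where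
  "composable G = {(x, y). x \<in> arrows G \<and> y \<in> arrows G \<and> gsrc G x = grng G y}"

definition units :: "'g top_groupoid \<Rightarrow> 'g set" where
  "units G = gsrc G ` arrows G"

definition unit_topology :: "'g top_groupoid \<Rightarrow> 'g topology" where
  "unit_topology G = subtopology (gtop G) (units G)"

text \<open>
  Since \<open>ginv\<close> is an involution, \<open>ginv x\<close> has source \<open>grng x\<close> and range \<open>gsrc x\<close>, so
  the products defining \<open>gsrc\<close> and \<open>grng\<close> are products of composable pairs.
\<close>

locale groupoid =
  fixes G :: "'g top_groupoid"
  assumes inv_closed: "x \<in> arrows G \<Longrightarrow> ginv G x \<in> arrows G"
    and inv_inv: "x \<in> arrows G \<Longrightarrow> ginv G (ginv G x) = x"
    and mul_closed: "(x, y) \<in> composable G \<Longrightarrow> gmul G x y \<in> arrows G"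
    and src_mul: "(x, y) \<in> composable G \<Longrightarrow> gsrc G (gmul G x y) = gsrc G y"
    and rng_mul: "(x, y) \<in> composable G \<Longrightarrow> grng G (gmul G x y) = grng G x"
    and mul_assoc: "(x, y) \<in> composable G \<Longrightarrow> (y, z) \<in> composable G \<Longrightarrow>
           gmul G (gmul G x y) z = gmul G x (gmul G y z)"
    and mul_src: "x \<in> arrows G \<Longrightarrow> gmul G x (gsrc G x) = x"
    and rng_mul_left: "x \<in> arrows G \<Longrightarrow> gmul G (grng G x) x = x"

locale topological_groupoid = groupoid +
  assumes continuous_inv: "continuous_map (gtop G) (gtop G) (ginv G)"
    and continuous_mul:
      "continuous_map (subtopology (prod_topology (gtop G) (gtop G)) (composable G)) (gtop G)
         (\<lambda>(x, y). gmul G x y)"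

text \<open>The map \<open>f\<close> restricts to a homeomorphism from \<open>U\<close> onto an open subset of \<open>Y\<close>.\<close>

definition homeo_onto_open :: "'a topology \<Rightarrow> 'b topology \<Rightarrow> ('a \<Rightarrow> 'b) \<Rightarrow> 'a set \<Rightarrow> bool" where
  "homeo_onto_open X Y f U \<longleftrightarrow>
     openin Y (f ` U) \<and> homeomorphic_map (subtopology X U) (subtopology Y (f ` U)) f"

definition local_homeomorphism :: "'a topology \<Rightarrow> 'b topology \<Rightarrow> ('a \<Rightarrow> 'b) \<Rightarrow> bool" where
  "local_homeomorphism X Y f \<longleftrightarrow>
     (\<forall>x\<in>topspace X. \<exists>U. openin X U \<and> x \<in> U \<and> homeo_onto_open X Y f U)"

locale etale_groupoid = topological_groupoid +
  assumes locally_compact_units: "locally_compact_space (unit_topology G)"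
    and Hausdorff_units: "Hausdorff_space (unit_topology G)"
    and src_local_homeo: "local_homeomorphism (gtop G) (unit_topology G) (gsrc G)"

definition open_bisection :: "'g top_groupoid \<Rightarrow> 'g set \<Rightarrow> bool" where
  "open_bisection G U \<longleftrightarrow> openin (gtop G) U \<and>
     homeo_onto_open (gtop G) (unit_topology G) (gsrc G) U \<and>
     homeo_onto_open (gtop G) (unit_topology G) (grng G) U"

definition compact_open_bisections :: "'g top_groupoid \<Rightarrow> 'g set set" where
  "compact_open_bisections G = {U. open_bisection G U \<and> compactin (gtop G) U}"

locale ample_groupoid = etale_groupoid +
  assumes base: "openin (gtop G) W \<Longrightarrow> \<exists>\<U> \<subseteq> compact_open_bisections G. \<Union>\<U> = W"

locale Hausdorff_ample_groupoid = ample_groupoid +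
  assumes Hausdorff: "Hausdorff_space (gtop G)"


section \<open>Nonunital algebras on subspaces of a vector space\<close>

text \<open>
  All notions below concern a subset \<open>A\<close> of a vector space with scalar multiplication \<open>sc\<close>,
  equipped with a product that matters only on \<open>A\<close>.
\<close>

definition commutator :: "('v \<Rightarrow> 'v \<Rightarrow> 'v) \<Rightarrow> 'v \<Rightarrow> 'v \<Rightarrow> 'v::ab_group_add" where
  "commutator mu x y = mu x y - mu y x"

definition product_span ::
    "('k::field \<Rightarrow> 'v \<Rightarrow> 'v) \<Rightarrow> ('v \<Rightarrow> 'v \<Rightarrow> 'v) \<Rightarrow> 'v set \<Rightarrow> 'v::ab_group_add set" where
  "product_span sc mu A = module.span sc {mu x y | x y. x \<in> A \<and> y \<in> A}"

text \<open>
  Simplicity as a condition on products and two-sided ideals only: the algebra axioms are not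
  part of it, so that they need not be assumed where the Steinberg algebra is assumed simple.
\<close>

definition simple_algebra ::
    "('k::field \<Rightarrow> 'v \<Rightarrow> 'v) \<Rightarrow> ('v \<Rightarrow> 'v \<Rightarrow> 'v) \<Rightarrow> 'v::ab_group_add set \<Rightarrow> bool" where
  "simple_algebra sc mu A \<longleftrightarrow> product_span sc mu A \<noteq> {0} \<and>
     (\<forall>I. module.subspace sc I \<and> I \<subseteq> A \<and> (\<forall>a\<in>A. \<forall>x\<in>I. mu a x \<in> I \<and> mu x a \<in> I)
        \<longrightarrow> I = {0} \<or> I = A)"

definition algebra_isomorphic ::
    "('k::field \<Rightarrow> 'v \<Rightarrow> 'v) \<Rightarrow> ('v \<Rightarrow> 'v \<Rightarrow> 'v) \<Rightarrow> 'v::ab_group_add set \<Rightarrow>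
     ('k \<Rightarrow> 'w \<Rightarrow> 'w) \<Rightarrow> ('w \<Rightarrow> 'w \<Rightarrow> 'w) \<Rightarrow> 'w::ab_group_add set \<Rightarrow> bool" where
  "algebra_isomorphic scA muA A scB muB B \<longleftrightarrow>
     (\<exists>\<phi>. bij_betw \<phi> A B \<and>
        (\<forall>x\<in>A. \<forall>y\<in>A. \<phi> (x + y) = \<phi> x + \<phi> y) \<and>
        (\<forall>c. \<forall>x\<in>A. \<phi> (scA c x) = scB c (\<phi> x)) \<and>
        (\<forall>x\<in>A. \<forall>y\<in>A. \<phi> (muA x y) = muB (\<phi> x) (\<phi> y)))"

locale lie_algebra_on = vector_space sc
  for sc :: "'k::field \<Rightarrow> 'v::ab_group_add \<Rightarrow> 'v" +
  fixes bracket :: "'v \<Rightarrow> 'v \<Rightarrow> 'v" and L :: "'v set"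
  assumes subspace: "subspace L"
    and bracket_closed: "x \<in> L \<Longrightarrow> y \<in> L \<Longrightarrow> bracket x y \<in> L"
    and bracket_add_left: "x \<in> L \<Longrightarrow> y \<in> L \<Longrightarrow> z \<in> L \<Longrightarrow>
           bracket (x + y) z = bracket x z + bracket y z"
    and bracket_add_right: "x \<in> L \<Longrightarrow> y \<in> L \<Longrightarrow> z \<in> L \<Longrightarrow>
           bracket x (y + z) = bracket x y + bracket x z"
    and bracket_scale_left: "x \<in> L \<Longrightarrow> y \<in> L \<Longrightarrow> bracket (sc c x) y = sc c (bracket x y)"
    and bracket_scale_right: "x \<in> L \<Longrightarrow> y \<in> L \<Longrightarrow> bracket x (sc c y) = sc c (bracket x y)"
    and bracket_self: "x \<in> L \<Longrightarrow> bracket x x = 0"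
    and jacobi: "x \<in> L \<Longrightarrow> y \<in> L \<Longrightarrow> z \<in> L \<Longrightarrow>
           bracket x (bracket y z) + bracket y (bracket z x) + bracket z (bracket x y) = 0"

locale simple_lie_algebra = lie_algebra_on +
  assumes nonabelian: "product_span sc bracket L \<noteq> {0}"
    and lie_ideals: "subspace I \<Longrightarrow> I \<subseteq> L \<Longrightarrow> (\<forall>a\<in>L. \<forall>x\<in>I. bracket a x \<in> I) \<Longrightarrow>
           I = {0} \<or> I = L"


section \<open>Steinberg algebras\<close>

definition fscale :: "'k::field \<Rightarrow> ('g \<Rightarrow> 'k) \<Rightarrow> 'g \<Rightarrow> 'k" where
  "fscale c f = (\<lambda>x. c * f x)"

lemma vector_space_fscale: "vector_space fscale"
  by unfold_locales (auto simp: fscale_def fun_eq_iff algebra_simps)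

text \<open>
  Functions on the groupoid are represented as functions on the ambient type vanishing outside
  the arrows.
\<close>

definition steinberg_algebra :: "'g top_groupoid \<Rightarrow> ('g \<Rightarrow> 'k::field) set" where
  "steinberg_algebra G = module.span fscale (indicator ` compact_open_bisections G)"

text \<open>
  The sum is restricted to the factorisations that contribute a nonzero term. For functions in
  the Steinberg algebra of a Hausdorff ample groupoid there are finitely many of these, whereas
  \<open>\<gamma>\<close> may have infinitely many factorisations, and a sum over an infinite set would be zero.
\<close>

definition convolution :: "'g top_groupoid \<Rightarrow> ('g \<Rightarrow> 'k) \<Rightarrow> ('g \<Rightarrow> 'k) \<Rightarrow> 'g \<Rightarrow> 'k::field" where
  "convolution G f g = (\<lambda>\<gamma>. \<Sum>(\<alpha>, \<beta>) | (\<alpha>, \<beta>) \<in> composable G \<and> gmul G \<alpha> \<beta> = \<gamma> \<and>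
     f \<alpha> \<noteq> 0 \<and> g \<beta> \<noteq> 0. f \<alpha> * g \<beta>)"

abbreviation steinberg_bracket ::
    "'g top_groupoid \<Rightarrow> ('g \<Rightarrow> 'k) \<Rightarrow> ('g \<Rightarrow> 'k) \<Rightarrow> 'g \<Rightarrow> 'k::field" where
  "steinberg_bracket G \<equiv> commutator (convolution G)"

definition steinberg_commutators :: "'g top_groupoid \<Rightarrow> ('g \<Rightarrow> 'k::field) set" where
  "steinberg_commutators G = product_span fscale (steinberg_bracket G) (steinberg_algebra G)"

end

theory Submission
  imports Defs
begin

text \<open>
  Let \<open>A\<close> be the Steinberg algebra and \<open>L = [A, A]\<close>. The characteristic functions of compact open
  sets of units are commuting idempotents, they provide local units for \<open>A\<close>, and disjoint sets give
  orthogonal idempotents. Apart from the case of at most two units, this is all that is needed from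
  the groupoid; the rest holds in every simple algebra with local units.

  Suppose that there are three units. Then \<open>A\<close> contains three orthogonal nonzero idempotents
  \<open>p, q, r\<close>. Let \<open>U\<close> be a subspace with \<open>[L, U] \<subseteq> U\<close>. The off-diagonal Peirce corners \<open>pAq\<close>, \<open>qAr\<close>, \<open>pAr\<close>
  lie in \<open>L\<close>, and for \<open>u \<in> U\<close>, \<open>X \<in> pAq\<close>, \<open>Y \<in> qAr\<close>, \<open>Z \<in> pAr\<close> one computes
  \<open>[[[u, X], Y] - [u, XY], Z] = XYuZ\<close>, without dividing by two. By simplicity the products \<open>XY\<close> span \<open>pAr\<close>, so
  \<open>pAr u pAr \<subseteq> U\<close>, and if \<open>rup \<noteq> 0\<close>, then by simplicity again \<open>pAr \<subseteq> U\<close> (\<open>corner_in_lie_ideal\<close>). From one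
  corner all off-diagonal corners are reached, and as they generate the whole corner algebra, \<open>U\<close>
  contains its commutators (\<open>bracket_in_lie_ideal\<close>). If on the other hand all elements of \<open>U\<close> are
  diagonal, they commute with the off-diagonal corners and hence with everything. Since \<open>p, q, r\<close>
  can be chosen to sum to a local unit for any given finite set of elements, \<open>U\<close> is central or
  contains \<open>L\<close> (\<open>lie_ideal_central_or_contains_commutators\<close>).

  A nonzero central element of a simple algebra is invertible, and \<open>L\<close> is a module over the centre;
  hence a nonzero central element of \<open>L\<close> gives an identity element of \<open>A\<close> that lies in \<open>L\<close>. The only
  possible identity element of a Steinberg algebra is \<open>1\<close> on the unit space, and it exists only if
  the unit space is compact. This settles the case of three units. Conversely, if \<open>1 \<in> L\<close>, then the
  multiples of \<open>1\<close> are a Lie ideal, which is incompatible with simplicity of \<open>L\<close>.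

  If \<open>u\<close> is an isolated unit and \<open>e\<close> its characteristic function, then \<open>eAe\<close> is the group algebra of
  the isotropy group at \<open>u\<close>. As \<open>A\<close> is simple, so is \<open>eAe\<close>, the augmentation ideal vanishes and
  \<open>eAe = Ke\<close> (\<open>scalar_corner\<close>). So with one unit \<open>A\<close> is \<open>K\<close>, and with two units \<open>A\<close> is the algebra of
  two-by-two matrices. In the latter case \<open>1 \<notin> L\<close> excludes characteristic two, where the identity
  matrix is the commutator of the two off-diagonal matrix units, and \<open>L\<close> is the simple Lie algebra of
  matrices of trace zero.
\<close>

section \<open>Associative algebras and their commutators\<close>

text \<open>
  The laws hold for all vectors, so that identities can be proved by rewriting without any
  membership conditions; the algebra of interest is a subspace \<open>A\<close> closed under the product.
\<close>
locale nonunital_algebra = vector_space scale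
  for scale :: "'k::field \<Rightarrow> 'v::ab_group_add \<Rightarrow> 'v" (infixr "\<odot>" 75) +
  fixes mult :: "'v \<Rightarrow> 'v \<Rightarrow> 'v" (infixl "\<cdot>" 70)
  assumes mult_assoc: "(x \<cdot> y) \<cdot> z = x \<cdot> (y \<cdot> z)"
    and mult_add_left: "(x + y) \<cdot> z = x \<cdot> z + y \<cdot> z"
    and mult_add_right: "x \<cdot> (y + z) = x \<cdot> y + x \<cdot> z"
    and mult_scale_left: "(c \<odot> x) \<cdot> y = c \<odot> (x \<cdot> y)"
    and mult_scale_right: "x \<cdot> (c \<odot> y) = c \<odot> (x \<cdot> y)"
begin

lemma mult_zero_left [simp]: "0 \<cdot> x = 0"
  using mult_add_left[of 0 0 x] by simp

lemma mult_zero_right [simp]: "x \<cdot> 0 = 0"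
  using mult_add_right[of x 0 0] by simp

lemma mult_diff_left: "(x - y) \<cdot> z = x \<cdot> z - y \<cdot> z"
  using mult_add_left[of "x - y" y z] by (simp add: eq_diff_eq)

lemma mult_diff_right: "x \<cdot> (y - z) = x \<cdot> y - x \<cdot> z"
  using mult_add_right[of x "y - z" z] by (simp add: eq_diff_eq)

lemma mult_minus_left: "(- x) \<cdot> y = - (x \<cdot> y)"
  using mult_diff_left[of 0 x y] by simp

lemma mult_minus_right: "x \<cdot> (- y) = - (x \<cdot> y)"
  using mult_diff_right[of x 0 y] by simp

lemmas mult_simps = mult_assoc mult_add_left mult_add_right mult_diff_left mult_diff_right
  mult_minus_left mult_minus_right mult_scale_left mult_scale_right

abbreviation bracket :: "'v \<Rightarrow> 'v \<Rightarrow> 'v" where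
  "bracket \<equiv> commutator mult"

lemma bracket_skew: "bracket x y = - bracket y x"
  by (simp add: commutator_def)

lemma subspace_sandwich:
  assumes "subspace W"
  shows "subspace {a. p \<cdot> a \<cdot> q \<in> W}"
  unfolding subspace_def
  using subspace_0[OF assms] subspace_add[OF assms] subspace_scale[OF assms]
  by (auto simp: mult_simps)

end

locale subalgebra = nonunital_algebra +
  fixes A :: "'b set"
  assumes subspace_A: "subspace A"
    and mult_closed [simp, intro]: "x \<in> A \<Longrightarrow> y \<in> A \<Longrightarrow> x \<cdot> y \<in> A"
begin

lemma A_closed [simp, intro]:
  "0 \<in> A" "x \<in> A \<Longrightarrow> y \<in> A \<Longrightarrow> x + y \<in> A" "x \<in> A \<Longrightarrow> y \<in> A \<Longrightarrow> x - y \<in> A"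
  "x \<in> A \<Longrightarrow> c \<odot> x \<in> A"
  using subspace_A by (auto simp: subspace_def subspace_diff)

definition commutators :: "'b set" where
  "commutators = product_span scale bracket A"

lemma bracket_closed [simp, intro]: "x \<in> A \<Longrightarrow> y \<in> A \<Longrightarrow> bracket x y \<in> A"
  by (auto simp: commutator_def)

lemma bracket_in_commutators [intro]: "x \<in> A \<Longrightarrow> y \<in> A \<Longrightarrow> bracket x y \<in> commutators"
  unfolding commutators_def product_span_def by (auto intro: span_base)

lemma subspace_commutators: "subspace commutators"
  unfolding commutators_def product_span_def by (rule subspace_span)

lemma commutators_least:
  assumes "subspace W" "\<And>x y. x \<in> A \<Longrightarrow> y \<in> A \<Longrightarrow> bracket x y \<in> W"
  shows "commutators \<subseteq> W"
  unfolding commutators_def product_span_def using assms by (intro span_minimal) auto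

lemma commutators_subset: "commutators \<subseteq> A"
  by (rule commutators_least[OF subspace_A]) auto

lemma commutators_in_A [simp, dest]: "x \<in> commutators \<Longrightarrow> x \<in> A"
  using commutators_subset by auto

lemma lie_algebra_on_commutators: "lie_algebra_on scale bracket commutators"
proof
  show "subspace commutators" by (rule subspace_commutators)
  show "bracket x y \<in> commutators" if "x \<in> commutators" "y \<in> commutators" for x y
    using that by auto
qed (auto simp: commutator_def mult_simps algebra_simps)

text \<open>On the off-diagonal corner \<open>pAq\<close> the bracket with \<open>p\<close> is the identity map.\<close>
lemma corner_in_commutators:
  assumes "p \<in> A" "a \<in> A" "q \<in> A" "p \<cdot> p = p" "q \<cdot> p = 0"
  shows "p \<cdot> a \<cdot> q \<in> commutators"
proof -
  have "p \<cdot> a \<cdot> q = bracket p (p \<cdot> a \<cdot> q)"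
    using assms mult_assoc[of p p "a \<cdot> q"] by (simp add: commutator_def mult_assoc)
  also have "\<dots> \<in> commutators" using assms by auto
  finally show ?thesis .
qed

text \<open>These are the ideals under the action of \<open>[A, A]\<close> only, and they may reach outside \<open>[A, A]\<close>.\<close>
definition lie_ideal :: "'b set \<Rightarrow> bool" where
  "lie_ideal U \<longleftrightarrow> subspace U \<and> U \<subseteq> A \<and> (\<forall>l\<in>commutators. \<forall>u\<in>U. bracket l u \<in> U)"

lemma lie_idealD:
  assumes "lie_ideal U"
  shows "subspace U" "u \<in> U \<Longrightarrow> u \<in> A"
    "l \<in> commutators \<Longrightarrow> u \<in> U \<Longrightarrow> bracket l u \<in> U"
    "l \<in> commutators \<Longrightarrow> u \<in> U \<Longrightarrow> bracket u l \<in> U"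
  using assms unfolding lie_ideal_def
  by (auto simp: bracket_skew[of u l] subspace_neg)

definition central :: "'b \<Rightarrow> bool" where
  "central z \<longleftrightarrow> z \<in> A \<and> (\<forall>a\<in>A. z \<cdot> a = a \<cdot> z)"

definition identity :: "'b \<Rightarrow> bool" where
  "identity e \<longleftrightarrow> e \<in> A \<and> (\<forall>a\<in>A. e \<cdot> a = a \<and> a \<cdot> e = a)"

lemma simple_lie_algebra_commutatorsI:
  assumes "\<And>U. lie_ideal U \<Longrightarrow> U \<subseteq> commutators \<Longrightarrow> U \<noteq> {0} \<Longrightarrow> commutators \<subseteq> U"
    and "x \<in> commutators" "y \<in> commutators" "bracket x y \<noteq> 0"
  shows "simple_lie_algebra scale bracket commutators"
proof -
  interpret L: lie_algebra_on scale bracket commutators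
    by (rule lie_algebra_on_commutators)
  show ?thesis
  proof
    have "bracket x y \<in> product_span scale bracket commutators"
      unfolding product_span_def using assms by (intro span_base) auto
    with assms show "product_span scale bracket commutators \<noteq> {0}" by auto
    fix I assume "subspace I" "I \<subseteq> commutators" "\<forall>a\<in>commutators. \<forall>x\<in>I. bracket a x \<in> I"
    then show "I = {0} \<or> I = commutators"
      using assms(1)[of I] commutators_subset by (auto simp: lie_ideal_def)
  qed
qed

text \<open>
  The multiples of the identity element form a Lie ideal on which the bracket vanishes. It cannot
  be zero, and it cannot be all of \<open>[A, A]\<close> since simple Lie algebras are not abelian.
\<close>
lemma identity_in_commutators_not_simple:
  assumes e: "identity e" "e \<noteq> 0" "e \<in> commutators"
  shows "\<not> simple_lie_algebra scale bracket commutators"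
proof
  assume "simple_lie_algebra scale bracket commutators"
  then interpret L: simple_lie_algebra scale bracket commutators .
  have zero: "bracket a x = 0" if "a \<in> A" "x \<in> span {e}" for a x
  proof -
    from that obtain c where "x = c \<odot> e" by (auto simp: span_singleton)
    with that e show ?thesis by (auto simp: commutator_def identity_def mult_simps)
  qed
  have "span {e} = {0} \<or> span {e} = commutators"
  proof (rule L.lie_ideals)
    show "span {e} \<subseteq> commutators"
      using e subspace_commutators by (intro span_minimal) auto
    show "\<forall>a\<in>commutators. \<forall>x\<in>span {e}. bracket a x \<in> span {e}"
      using zero by (auto simp: span_zero)
  qed auto
  moreover have "span {e} \<noteq> {0}" using e span_base[of e "{e}"] by auto
  ultimately have comm: "commutators = span {e}" by auto
  have "product_span scale bracket commutators \<subseteq> {0}"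
    unfolding product_span_def
  proof (rule span_minimal)
    show "{bracket x y |x y. x \<in> commutators \<and> y \<in> commutators} \<subseteq> {0}"
      using zero comm commutators_subset by auto
  qed auto
  then have "product_span scale bracket commutators = {0}"
    by (auto simp: product_span_def span_zero)
  with L.nonabelian show False by simp
qed

end

section \<open>Simple algebras with local units\<close>

locale simple_subalgebra = subalgebra +
  assumes simple: "simple_algebra scale mult A"
    and local_units: "finite F \<Longrightarrow> F \<subseteq> A \<Longrightarrow>
          \<exists>f\<in>A. f \<cdot> f = f \<and> (\<forall>x\<in>F. f \<cdot> x = x \<and> x \<cdot> f = x)"
begin

lemma local_unitE:
  assumes "finite F" "F \<subseteq> A"
  obtains f where "f \<in> A" "f \<cdot> f = f" "\<And>x. x \<in> F \<Longrightarrow> f \<cdot> x = x" "\<And>x. x \<in> F \<Longrightarrow> x \<cdot> f = x"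
  using local_units[OF assms] by auto

lemma simple_idealD:
  assumes "subspace I" "I \<subseteq> A" "\<And>a x. a \<in> A \<Longrightarrow> x \<in> I \<Longrightarrow> a \<cdot> x \<in> I"
    "\<And>a x. a \<in> A \<Longrightarrow> x \<in> I \<Longrightarrow> x \<cdot> a \<in> I" "c \<in> I" "c \<noteq> 0"
  shows "I = A"
proof -
  have "I = {0} \<or> I = A"
    using simple assms(1-4) unfolding simple_algebra_def by simp
  with assms(5,6) show ?thesis by auto
qed

text \<open>
  By simplicity the two-sided ideal generated by a nonzero element \<open>c\<close> is \<open>A\<close>, and since \<open>c\<close> has a local
  unit that ideal is spanned by the products \<open>xcy\<close>. A linear property of the elements of \<open>A\<close> may
  therefore be checked on these products alone. This is how simplicity is used throughout.
\<close>
lemma sandwich_induct [consumes 3, case_names subspace sandwich]: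
  assumes "c \<in> A" "c \<noteq> 0" "a \<in> A"
    and W: "subspace {x. P x}"
    and base: "\<And>x y. x \<in> A \<Longrightarrow> y \<in> A \<Longrightarrow> P (x \<cdot> c \<cdot> y)"
  shows "P a"
proof -
  define S where "S = {x \<cdot> c \<cdot> y |x y. x \<in> A \<and> y \<in> A}"
  have ideal: "b \<cdot> x \<in> span S \<and> x \<cdot> b \<in> span S" if "b \<in> A" "x \<in> span S" for b x
    using that(2)
  proof (induction rule: span_induct)
    case base
    show ?case
      unfolding subspace_def by (auto simp: mult_simps span_zero span_add span_scale)
  next
    case (step z)
    then obtain x y where z: "z = x \<cdot> c \<cdot> y" "x \<in> A" "y \<in> A" by (auto simp: S_def)
    have "b \<cdot> z = (b \<cdot> x) \<cdot> c \<cdot> y" "z \<cdot> b = x \<cdot> c \<cdot> (y \<cdot> b)"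
      by (simp_all add: z mult_simps)
    moreover have "b \<cdot> x \<in> A" "y \<cdot> b \<in> A" using z \<open>b \<in> A\<close> by auto
    ultimately have "b \<cdot> z \<in> S" "z \<cdot> b \<in> S"
      using z(2,3) unfolding S_def by blast+
    then show ?case by (simp add: span_base)
  qed
  obtain f where f: "f \<in> A" "f \<cdot> c = c" "c \<cdot> f = c"
    using local_unitE[of "{c}"] assms(1) by auto
  have "f \<cdot> c \<cdot> f \<in> S" using f(1) unfolding S_def by blast
  then have "c \<in> S" using f by simp
  moreover have "S \<subseteq> A" using assms(1) by (auto simp: S_def)
  then have "span S \<subseteq> A" using subspace_A by (rule span_minimal)
  ultimately have "span S = A"
    using ideal assms(2) by (intro simple_idealD[of "span S" c]) (simp_all add: span_base)
  moreover have "span S \<subseteq> {x. P x}"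
    using base by (intro span_minimal[OF _ W]) (auto simp: S_def)
  ultimately show ?thesis using assms(3) by auto
qed

lemma prime_product:
  assumes "p \<in> A" "q \<in> A" "p \<noteq> 0" "q \<noteq> 0"
  shows "\<exists>a\<in>A. p \<cdot> a \<cdot> q \<noteq> 0"
proof (rule ccontr)
  assume "\<not> ?thesis"
  then have zero: "p \<cdot> a \<cdot> q = 0" if "a \<in> A" for a using that by blast
  obtain f where f: "f \<in> A" "p \<cdot> f = p"
    using local_unitE[of "{p}"] assms by auto
  from \<open>q \<in> A\<close> \<open>q \<noteq> 0\<close> \<open>f \<in> A\<close> have "p \<cdot> f = 0"
  proof (induction rule: sandwich_induct)
    case subspace
    show ?case by (auto simp: subspace_def mult_simps)
  next
    case (sandwich x y)
    then show ?case using zero[of x] by (simp flip: mult_assoc)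
  qed
  with f assms show False by simp
qed

section \<open>Lie ideals and three orthogonal idempotents\<close>

definition orthogonal_idempotents :: "'b \<Rightarrow> 'b \<Rightarrow> 'b \<Rightarrow> bool" where
  "orthogonal_idempotents p q r \<longleftrightarrow> {p, q, r} \<subseteq> A - {0} \<and>
     p \<cdot> p = p \<and> q \<cdot> q = q \<and> r \<cdot> r = r \<and>
     p \<cdot> q = 0 \<and> q \<cdot> p = 0 \<and> p \<cdot> r = 0 \<and> r \<cdot> p = 0 \<and> q \<cdot> r = 0 \<and> r \<cdot> q = 0"

lemma orthogonal_idempotents_permute:
  assumes "orthogonal_idempotents p q r"
  shows "orthogonal_idempotents p r q" "orthogonal_idempotents r p q" "orthogonal_idempotents r q p"
    "orthogonal_idempotents q p r" "orthogonal_idempotents q r p"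
  using assms by (auto simp: orthogonal_idempotents_def)

lemma orthogonal_idempotentsD:
  assumes "orthogonal_idempotents p q r"
  shows "p \<in> A" "q \<in> A" "r \<in> A" "p \<noteq> 0" "q \<noteq> 0" "r \<noteq> 0"
    "p \<cdot> p = p" "q \<cdot> q = q" "r \<cdot> r = r"
    "p \<cdot> q = 0" "q \<cdot> p = 0" "p \<cdot> r = 0" "r \<cdot> p = 0" "q \<cdot> r = 0" "r \<cdot> q = 0"
    "p \<cdot> (p \<cdot> x) = p \<cdot> x" "q \<cdot> (q \<cdot> x) = q \<cdot> x" "r \<cdot> (r \<cdot> x) = r \<cdot> x"
    "p \<cdot> (q \<cdot> x) = 0" "q \<cdot> (p \<cdot> x) = 0" "p \<cdot> (r \<cdot> x) = 0" "r \<cdot> (p \<cdot> x) = 0"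
    "q \<cdot> (r \<cdot> x) = 0" "r \<cdot> (q \<cdot> x) = 0"
  using assms by (auto simp: orthogonal_idempotents_def simp flip: mult_assoc)

text \<open>
  Three idempotents give enough room to produce \<open>XYuZ\<close> by brackets alone; with only two of them, the
  brackets give \<open>-2XuX\<close>, which is useless in characteristic two.
\<close>
lemma corner_in_lie_ideal:
  assumes U: "lie_ideal U" and pqr: "orthogonal_idempotents p q r"
    and u: "u \<in> U" "r \<cdot> u \<cdot> p \<noteq> 0" and a: "a \<in> A"
  shows "p \<cdot> a \<cdot> r \<in> U"
proof -
  note [simp] = orthogonal_idempotentsD[OF pqr]
  note D = lie_idealD[OF U]
  have uA: "u \<in> A" using D u by auto
  have base: "X \<cdot> Y \<cdot> u \<cdot> Z \<in> U"
    if X: "X = p \<cdot> x \<cdot> q" "x \<in> A" and Y: "Y = q \<cdot> y \<cdot> r" "y \<in> A" and Z: "Z = p \<cdot> z \<cdot> r" "z \<in> A"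
    for X Y Z x y z
  proof -
    have L: "X \<in> commutators" "Y \<in> commutators" "Z \<in> commutators"
      unfolding X Y Z using that by (auto intro!: corner_in_commutators)
    have "X \<cdot> Y = p \<cdot> (x \<cdot> q \<cdot> y) \<cdot> r" by (simp add: X Y mult_assoc)
    then have XY: "X \<cdot> Y \<in> commutators"
      using corner_in_commutators[of p "x \<cdot> q \<cdot> y" r] that by auto
    \<comment> \<open>Of the terms of the triple bracket below only \<open>XYuZ\<close> survives these relations.\<close>
    have zero: "Y \<cdot> X = 0" "Y \<cdot> Z = 0" "X \<cdot> Z = 0" "Z \<cdot> X = 0" "Z \<cdot> Y = 0"
      "Y \<cdot> (X \<cdot> w) = 0" "Y \<cdot> (Z \<cdot> w) = 0" "X \<cdot> (Z \<cdot> w) = 0" "Z \<cdot> (X \<cdot> w) = 0" "Z \<cdot> (Y \<cdot> w) = 0" for w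
      by (simp_all add: X Y Z mult_assoc)
    have "X \<cdot> Y \<cdot> u \<cdot> Z = bracket (bracket (bracket u X) Y - bracket u (X \<cdot> Y)) Z"
      by (simp add: commutator_def mult_simps zero)
    also have "\<dots> \<in> U"
      using u L XY D(1) by (intro D(4) subspace_diff) auto
    finally show ?thesis .
  qed
  \<comment> \<open>The products \<open>XY\<close> span \<open>pAr\<close>, since \<open>A\<close> is spanned by \<open>AqA\<close>.\<close>
  have step: "p \<cdot> x \<cdot> (r \<cdot> u \<cdot> p \<cdot> y \<cdot> r) \<in> U" if "x \<in> A" "y \<in> A" for x y
    using orthogonal_idempotentsD(2,5)[OF pqr] \<open>x \<in> A\<close>
  proof (induction rule: sandwich_induct)
    case subspace
    show ?case by (rule subspace_sandwich[OF D(1)])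
  next
    case (sandwich x x')
    then show ?case
      using base[OF refl _ refl _ refl, of x x' y] \<open>y \<in> A\<close> by (simp add: mult_assoc)
  qed
  \<comment> \<open>Now \<open>pAr\<close> is spanned by \<open>pA(rup)Ar\<close>, since \<open>rup\<close> generates \<open>A\<close> as an ideal.\<close>
  have "r \<cdot> u \<cdot> p \<in> A" using uA by simp
  from this u(2) a show ?thesis
  proof (induction rule: sandwich_induct)
    case subspace
    show ?case by (rule subspace_sandwich[OF D(1)])
  next
    case (sandwich x y)
    then show ?case using step[of x y] by (simp add: mult_assoc)
  qed
qed

text \<open>
  The corner opposite to \<open>pAr\<close> is reached by the previous lemma, as \<open>pAr\<close> contains a nonzero element,
  and \<open>pAq\<close> is spanned by the brackets of \<open>pAr\<close> with \<open>rAq\<close>. These two moves connect all six corners.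
\<close>
lemma all_corners_in_lie_ideal:
  assumes U: "lie_ideal U" and pqr: "orthogonal_idempotents p q r"
    and pr: "\<And>a. a \<in> A \<Longrightarrow> p \<cdot> a \<cdot> r \<in> U"
    and st: "s \<in> {p, q, r}" "t \<in> {p, q, r}" "s \<noteq> t" and a: "a \<in> A"
  shows "s \<cdot> a \<cdot> t \<in> U"
proof -
  note D = lie_idealD[OF U]
  have opposite: "z \<cdot> a \<cdot> x \<in> U"
    if o: "orthogonal_idempotents x y z" and xz: "\<And>a. a \<in> A \<Longrightarrow> x \<cdot> a \<cdot> z \<in> U" and "a \<in> A" for x y z a
  proof -
    note [simp] = orthogonal_idempotentsD[OF o]
    obtain b where b: "b \<in> A" "x \<cdot> b \<cdot> z \<noteq> 0" using prime_product[of x z] by auto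
    from corner_in_lie_ideal[OF U orthogonal_idempotents_permute(3)[OF o] xz[OF b(1)] _ \<open>a \<in> A\<close>] b(2) show ?thesis
      by (simp add: mult_assoc)
  qed
  have right: "x \<cdot> a \<cdot> y \<in> U"
    if o: "orthogonal_idempotents x y z" and xz: "\<And>a. a \<in> A \<Longrightarrow> x \<cdot> a \<cdot> z \<in> U" and "a \<in> A" for x y z a
  proof -
    note [simp] = orthogonal_idempotentsD[OF o]
    from orthogonal_idempotentsD(3,6)[OF o] \<open>a \<in> A\<close> show ?thesis
    proof (induction rule: sandwich_induct)
      case subspace
      show ?case by (rule subspace_sandwich[OF D(1)])
    next
      case (sandwich b c)
      have "bracket (x \<cdot> b \<cdot> z) (z \<cdot> c \<cdot> y) \<in> U"
        using sandwich by (intro D(4) xz corner_in_commutators) auto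
      then show ?case by (simp add: commutator_def mult_assoc)
    qed
  qed
  note o = orthogonal_idempotents_permute[OF pqr]
  have rp: "r \<cdot> a \<cdot> p \<in> U" if "a \<in> A" for a using opposite[OF pqr pr that] .
  have pq: "p \<cdot> a \<cdot> q \<in> U" if "a \<in> A" for a using right[OF pqr pr that] .
  have rq: "r \<cdot> a \<cdot> q \<in> U" if "a \<in> A" for a using right[OF o(3) rp that] .
  have qp: "q \<cdot> a \<cdot> p \<in> U" if "a \<in> A" for a using opposite[OF o(1) pq that] .
  have qr: "q \<cdot> a \<cdot> r \<in> U" if "a \<in> A" for a using opposite[OF o(2) rq that] .
  show ?thesis using st a pr rp pq rq qp qr by auto
qed

lemma orthogonal_idempotents_choose:
  assumes pqr: "orthogonal_idempotents p q r" and "s \<in> {p, q, r}" "t \<in> {p, q, r}" "s \<noteq> t"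
  obtains w where "orthogonal_idempotents s w t" "{s, w, t} = {p, q, r}"
proof -
  have "\<exists>w. orthogonal_idempotents s w t \<and> {s, w, t} = {p, q, r}"
    using assms(2-) pqr orthogonal_idempotents_permute[OF pqr] by auto
  then show thesis using that by auto
qed

text \<open>
  With \<open>f = p + q + r\<close>, the algebra \<open>fAf\<close> is generated by its off-diagonal corners: the diagonal corner
  \<open>sAs\<close> is spanned by the products of \<open>sAt\<close> with \<open>tAs\<close>, again because \<open>t\<close> generates \<open>A\<close> as an ideal.
\<close>
lemma corner_generation_induct [consumes 5, case_names subspace product corner]:
  assumes pqr: "orthogonal_idempotents p q r" and f: "f = p + q + r"
    and a: "a \<in> A" "f \<cdot> a = a" "a \<cdot> f = a"
    and P: "subspace {x. P x}"
    and product: "\<And>x y. P x \<Longrightarrow> P y \<Longrightarrow> P (x \<cdot> y)"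
    and corner: "\<And>s w t x. orthogonal_idempotents s w t \<Longrightarrow> f = s + w + t \<Longrightarrow> {s, w, t} = {p, q, r} \<Longrightarrow>
                   x \<in> A \<Longrightarrow> P (s \<cdot> x \<cdot> t)"
  shows "P a"
proof -
  have diag: "P (s \<cdot> x \<cdot> s)"
    if o: "orthogonal_idempotents s w t" "f = s + w + t" "{s, w, t} = {p, q, r}" and "x \<in> A" for s w t x
    using orthogonal_idempotentsD(3,6)[OF o(1)] \<open>x \<in> A\<close>
  proof (induction rule: sandwich_induct)
    case subspace
    show ?case using subspace_sandwich[OF P] by simp
  next
    case (sandwich x y)
    have "P (s \<cdot> x \<cdot> t)" by (rule corner[OF o sandwich(1)])
    moreover have "P (t \<cdot> y \<cdot> s)"
      using o orthogonal_idempotents_permute(3)[OF o(1)] sandwich(2)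
      by (intro corner[of t w s]) (auto simp: ac_simps)
    ultimately have "P (s \<cdot> x \<cdot> t \<cdot> (t \<cdot> y \<cdot> s))" by (rule product)
    then show ?case by (simp add: mult_assoc orthogonal_idempotentsD[OF o(1)])
  qed
  note o = orthogonal_idempotents_permute[OF pqr]
  have sum: "f = p + r + q" "f = r + p + q" "f = r + q + p" "f = q + p + r" "f = q + r + p"
    by (simp_all add: f ac_simps)
  note c = corner[OF pqr f refl a(1)] corner[OF o(1) sum(1) _ a(1)] corner[OF o(2) sum(2) _ a(1)]
    corner[OF o(3) sum(3) _ a(1)] corner[OF o(4) sum(4) _ a(1)] corner[OF o(5) sum(5) _ a(1)]
    diag[OF pqr f refl a(1)] diag[OF o(2) sum(2) _ a(1)] diag[OF o(4) sum(4) _ a(1)]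
  have c': "P (p \<cdot> a \<cdot> r)" "P (p \<cdot> a \<cdot> q)" "P (r \<cdot> a \<cdot> q)" "P (r \<cdot> a \<cdot> p)" "P (q \<cdot> a \<cdot> r)" "P (q \<cdot> a \<cdot> p)"
    "P (p \<cdot> a \<cdot> p)" "P (r \<cdot> a \<cdot> r)" "P (q \<cdot> a \<cdot> q)"
    by (auto intro: c)
  have add: "P (x + y)" if "P x" "P y" for x y
    using P that by (auto simp: subspace_def)
  have "a = f \<cdot> a \<cdot> f" using a by simp
  also have "\<dots> = p \<cdot> a \<cdot> p + p \<cdot> a \<cdot> q + p \<cdot> a \<cdot> r + (q \<cdot> a \<cdot> p + q \<cdot> a \<cdot> q + q \<cdot> a \<cdot> r)
      + (r \<cdot> a \<cdot> p + r \<cdot> a \<cdot> q + r \<cdot> a \<cdot> r)"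
    by (simp add: f mult_simps)
  finally show ?thesis
    by (metis add c')
qed

text \<open>
  The elements \<open>x\<close> of \<open>fAf\<close> with \<open>[x, fAf] \<subseteq> U\<close> are closed under products because
  \<open>[xy, z] = [x, yz] + [y, zx]\<close>, so it suffices to consider off-diagonal \<open>x\<close>.
\<close>
lemma bracket_in_lie_ideal:
  assumes U: "lie_ideal U" and pqr: "orthogonal_idempotents p q r" and f: "f = p + q + r"
    and corners: "\<And>s t x. s \<in> {p, q, r} \<Longrightarrow> t \<in> {p, q, r} \<Longrightarrow> s \<noteq> t \<Longrightarrow> x \<in> A \<Longrightarrow> s \<cdot> x \<cdot> t \<in> U"
    and b: "b \<in> A" "f \<cdot> b = b" "b \<cdot> f = b" and c: "c \<in> A" "f \<cdot> c = c" "c \<cdot> f = c"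
  shows "bracket b c \<in> U"
proof -
  note D = lie_idealD[OF U]
  define P where "P x \<longleftrightarrow> x \<in> A \<and> f \<cdot> x = x \<and> x \<cdot> f = x \<and>
    (\<forall>y\<in>A. f \<cdot> y = y \<longrightarrow> y \<cdot> f = y \<longrightarrow> bracket x y \<in> U)" for x
  from pqr f b have "P b"
  proof (induction rule: corner_generation_induct)
    case subspace
    have 1: "bracket (x + x') y = bracket x y + bracket x' y" for x x' y
      by (simp add: commutator_def mult_simps)
    have 2: "bracket (k \<odot> x) y = k \<odot> bracket x y" for k x y
      by (simp add: commutator_def mult_simps scale_right_diff_distrib)
    have 3: "bracket 0 y = 0" for y by (simp add: commutator_def)
    show ?case unfolding subspace_def P_def mem_Collect_eq 1 2 3
      using subspace_0[OF D(1)] subspace_add[OF D(1)] subspace_scale[OF D(1)]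
      by (simp add: mult_simps)
  next
    case (product x y)
    then have xy: "x \<in> A" "y \<in> A" "f \<cdot> x = x" "x \<cdot> f = x" "f \<cdot> y = y" "y \<cdot> f = y" by (auto simp: P_def)
    have "bracket (x \<cdot> y) z \<in> U" if z: "z \<in> A" "f \<cdot> z = z" "z \<cdot> f = z" for z
    proof -
      have "f \<cdot> (y \<cdot> z) = y \<cdot> z" "f \<cdot> (z \<cdot> x) = z \<cdot> x" using xy z by (simp_all flip: mult_assoc)
      moreover have "y \<cdot> z \<cdot> f = y \<cdot> z" "z \<cdot> x \<cdot> f = z \<cdot> x" using xy z by (simp_all add: mult_assoc)
      ultimately have "bracket x (y \<cdot> z) \<in> U" "bracket y (z \<cdot> x) \<in> U"
        using product xy z(1) unfolding P_def by blast+
      then have "bracket x (y \<cdot> z) + bracket y (z \<cdot> x) \<in> U" by (rule subspace_add[OF D(1)])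
      moreover have "bracket x (y \<cdot> z) + bracket y (z \<cdot> x) = bracket (x \<cdot> y) z"
        by (simp add: commutator_def mult_simps)
      ultimately show ?thesis by simp
    qed
    moreover have "f \<cdot> (x \<cdot> y) = x \<cdot> y" "x \<cdot> y \<cdot> f = x \<cdot> y"
      using xy by (simp add: xy flip: mult_assoc, simp add: mult_assoc)
    ultimately show ?case using xy by (simp add: P_def)
  next
    case (corner s w t x)
    note [simp] = orthogonal_idempotentsD[OF corner(1)]
    have ne: "s \<noteq> t" "s \<noteq> w" "w \<noteq> t"
      using orthogonal_idempotentsD(4-15)[OF corner(1)] by metis+
    have xA: "x \<in> A" by fact
    have in_U: "s \<cdot> y \<cdot> t \<in> U" "s \<cdot> y \<cdot> w \<in> U" "w \<cdot> y \<cdot> t \<in> U" if "y \<in> A" for y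
      using corner(3) ne that by (auto intro!: corners)
    have "bracket (s \<cdot> x \<cdot> t) y \<in> U" if y: "y \<in> A" "f \<cdot> y = y" "y \<cdot> f = y" for y
    proof -
      have "bracket (s \<cdot> x \<cdot> t) (t \<cdot> y \<cdot> s) \<in> U"
        using in_U xA y by (intro D(4) corner_in_commutators) auto
      \<comment> \<open>Of the Peirce components of \<open>[sxt, y]\<close>, those in \<open>sAs\<close> and \<open>tAt\<close> form \<open>[sxt, tys]\<close>.\<close>
      moreover have "bracket (s \<cdot> x \<cdot> t) y = s \<cdot> x \<cdot> t \<cdot> (y \<cdot> f) - (f \<cdot> y) \<cdot> (s \<cdot> x \<cdot> t)"
        unfolding y(2,3) by (simp add: commutator_def)
      then have "bracket (s \<cdot> x \<cdot> t) y = bracket (s \<cdot> x \<cdot> t) (t \<cdot> y \<cdot> s)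
          + (s \<cdot> (x \<cdot> t \<cdot> y) \<cdot> t + s \<cdot> (x \<cdot> t \<cdot> y) \<cdot> w) - (s \<cdot> (y \<cdot> s \<cdot> x) \<cdot> t + w \<cdot> (y \<cdot> s \<cdot> x) \<cdot> t)"
        by (simp add: commutator_def mult_simps corner(2) algebra_simps)
      ultimately show ?thesis
        using in_U xA y(1) by (simp add: subspace_add[OF D(1)] subspace_diff[OF D(1)])
    qed
    then show ?case using xA unfolding P_def by (simp add: corner(2) mult_simps)
  qed
  then show ?thesis using c by (simp add: P_def)
qed

text \<open>
  If \<open>U\<close> consists of diagonal elements, then for \<open>u \<in> U\<close> and off-diagonal \<open>x\<close> the bracket \<open>[u, x]\<close> is
  off-diagonal as well as, being in \<open>U\<close>, diagonal; so it vanishes.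
\<close>
lemma commute_if_corners_zero:
  assumes U: "lie_ideal U" and pqr: "orthogonal_idempotents p q r" and f: "f = p + q + r"
    and zero: "\<And>s t u. s \<in> {p, q, r} \<Longrightarrow> t \<in> {p, q, r} \<Longrightarrow> s \<noteq> t \<Longrightarrow> u \<in> U \<Longrightarrow> s \<cdot> u \<cdot> t = 0"
    and u: "u \<in> U" "f \<cdot> u = u" "u \<cdot> f = u" and a: "a \<in> A" "f \<cdot> a = a" "a \<cdot> f = a"
  shows "u \<cdot> a = a \<cdot> u"
  using pqr f a
proof (induction rule: corner_generation_induct)
  case subspace
  show ?case by (auto simp: subspace_def mult_simps)
next
  case (product x y)
  then have "u \<cdot> x \<cdot> y = x \<cdot> u \<cdot> y" "x \<cdot> (u \<cdot> y) = x \<cdot> (y \<cdot> u)" by simp_all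
  then show ?case by (simp add: mult_assoc)
next
  case (corner s w t x)
  note [simp] = orthogonal_idempotentsD[OF corner(1)]
  note D = lie_idealD[OF U]
  have ne: "s \<noteq> t" "s \<noteq> w" "w \<noteq> t"
    using orthogonal_idempotentsD(4-15)[OF corner(1)] by metis+
  have z: "s \<cdot> v \<cdot> t = 0" "w \<cdot> v \<cdot> s = 0" "t \<cdot> v \<cdot> s = 0" "t \<cdot> v \<cdot> w = 0" if "v \<in> U" for v
    using corner(3) ne that by (auto intro!: zero)
  have us: "u \<cdot> s = s \<cdot> u \<cdot> s"
  proof -
    have "u \<cdot> s = f \<cdot> u \<cdot> s" using u by simp
    also have "\<dots> = s \<cdot> u \<cdot> s" using z[OF u(1)] by (simp add: corner(2) mult_add_left)
    finally show ?thesis .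
  qed
  have tu: "t \<cdot> u = t \<cdot> u \<cdot> t"
  proof -
    have "t \<cdot> u = t \<cdot> u \<cdot> f" using u by (simp add: mult_assoc)
    also have "\<dots> = t \<cdot> u \<cdot> t" using z[OF u(1)] by (simp add: corner(2) mult_add_right)
    finally show ?thesis .
  qed
  have "bracket u (s \<cdot> x \<cdot> t) \<in> U"
    using corner(4) u(1) by (intro D(4) corner_in_commutators) auto
  then have "0 = s \<cdot> bracket u (s \<cdot> x \<cdot> t) \<cdot> t" using z by simp
  also have "\<dots> = s \<cdot> u \<cdot> s \<cdot> x \<cdot> t - s \<cdot> x \<cdot> (t \<cdot> u \<cdot> t)"
    by (simp add: commutator_def mult_simps)
  also have "\<dots> = u \<cdot> s \<cdot> x \<cdot> t - s \<cdot> x \<cdot> (t \<cdot> u)" using us tu by simp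
  finally show ?case by (simp add: mult_assoc)
qed

theorem lie_ideal_central_or_contains_commutators:
  assumes pqr: "orthogonal_idempotents p q r" and U: "lie_ideal U"
  shows "(\<forall>u\<in>U. central u) \<or> commutators \<subseteq> U"
proof (cases "\<forall>u\<in>U. central u")
  case False
  note D = lie_idealD[OF U] and pqr' = orthogonal_idempotentsD[OF pqr]
  with False obtain u a where u: "u \<in> U" "a \<in> A" "u \<cdot> a \<noteq> a \<cdot> u" by (auto simp: central_def)
  have "commutators \<subseteq> U"
  proof (rule commutators_least[OF D(1)])
    fix b c assume bc: "b \<in> A" "c \<in> A"
    have "{u, a, b, c, p, q, r} \<subseteq> A" using bc u D(2) pqr' by auto
    with local_unitE[of "{u, a, b, c, p, q, r}"] obtain f where f: "f \<in> A" "f \<cdot> f = f"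
      "\<And>x. x \<in> {u, a, b, c, p, q, r} \<Longrightarrow> f \<cdot> x = x" "\<And>x. x \<in> {u, a, b, c, p, q, r} \<Longrightarrow> x \<cdot> f = x"
      by (metis finite.emptyI finite.insertI)
    have [simp]: "f \<cdot> p = p" "p \<cdot> f = p" "f \<cdot> q = q" "q \<cdot> f = q" "f \<cdot> r = r" "r \<cdot> f = r"
      using f by auto
    \<comment> \<open>Enlarging the third idempotent makes the sum a local unit for all elements in question.\<close>
    define r' where "r' = f - p - q"
    have "r' \<cdot> r \<noteq> 0" using pqr' by (simp add: r'_def mult_simps)
    then have "r' \<noteq> 0" by auto
    then have o: "orthogonal_idempotents p q r'"
      using pqr' f(1,2) unfolding orthogonal_idempotents_def by (simp add: r'_def mult_simps)
    have f': "f = p + q + r'" by (simp add: r'_def)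
    obtain s t v where st: "s \<in> {p, q, r'}" "t \<in> {p, q, r'}" "s \<noteq> t" "v \<in> U" "s \<cdot> v \<cdot> t \<noteq> 0"
    proof (rule ccontr)
      assume "\<not> thesis"
      with that have zero: "s \<cdot> v \<cdot> t = 0"
        if "s \<in> {p, q, r'}" "t \<in> {p, q, r'}" "s \<noteq> t" "v \<in> U" for s t v
        using that by blast
      from commute_if_corners_zero[OF U o f' this, of u a] u f show False by simp
    qed
    obtain w where w: "orthogonal_idempotents t w s" "{t, w, s} = {p, q, r'}"
      using orthogonal_idempotents_choose[OF o st(2,1)] st(3) by metis
    have "\<And>x. x \<in> A \<Longrightarrow> t \<cdot> x \<cdot> s \<in> U" by (rule corner_in_lie_ideal[OF U w(1) st(4,5)])
    from all_corners_in_lie_ideal[OF U w(1) this]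
    have "s \<cdot> x \<cdot> t \<in> U" if "s \<in> {p, q, r'}" "t \<in> {p, q, r'}" "s \<noteq> t" "x \<in> A" for s t x
      using that unfolding w(2) by blast
    then show "bracket b c \<in> U"
      by (rule bracket_in_lie_ideal[OF U o f']) (use bc f in auto)
  qed
  then show ?thesis ..
qed simp

text \<open>
  The ideal \<open>zA\<close> is \<open>A\<close>, so a local unit \<open>e\<close> of \<open>z\<close> is an identity element and \<open>e = zw\<close> for some \<open>w\<close>, which
  is central too. As \<open>w[x, y] = [wx, y]\<close>, multiplication by \<open>w\<close> preserves \<open>[A, A]\<close> and takes \<open>z\<close> to \<open>e\<close>.
\<close>
lemma identity_of_central_commutator:
  assumes z: "central z" "z \<noteq> 0" "z \<in> commutators"
  obtains e where "identity e" "e \<in> commutators"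
proof -
  have zA: "z \<in> A" and zc: "\<And>a. a \<in> A \<Longrightarrow> z \<cdot> a = a \<cdot> z" using z by (auto simp: central_def)
  obtain e where e: "e \<in> A" "e \<cdot> z = z" "z \<cdot> e = z" using local_unitE[of "{z}"] zA by auto
  have *: "(\<lambda>a. z \<cdot> a) ` A = A"
  proof (rule simple_idealD)
    show "subspace ((\<lambda>a. z \<cdot> a) ` A)"
      unfolding subspace_def
    proof (intro conjI ballI allI)
      show "0 \<in> (\<lambda>a. z \<cdot> a) ` A" using A_closed(1) by force
    next
      fix x y assume "x \<in> (\<lambda>a. z \<cdot> a) ` A" "y \<in> (\<lambda>a. z \<cdot> a) ` A"
      then show "x + y \<in> (\<lambda>a. z \<cdot> a) ` A" by (auto simp flip: mult_add_right)
    next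
      fix c x assume "x \<in> (\<lambda>a. z \<cdot> a) ` A"
      then show "c \<odot> x \<in> (\<lambda>a. z \<cdot> a) ` A" by (auto simp flip: mult_scale_right)
    qed
    show "(\<lambda>a. z \<cdot> a) ` A \<subseteq> A" using zA by auto
    show "z \<in> (\<lambda>a. z \<cdot> a) ` A" using e by force
    show "z \<noteq> 0" by fact
    fix a x assume ax: "a \<in> A" "x \<in> (\<lambda>a. z \<cdot> a) ` A"
    then obtain y where y: "y \<in> A" "x = z \<cdot> y" by auto
    have "a \<cdot> x = z \<cdot> (a \<cdot> y)" "x \<cdot> a = z \<cdot> (y \<cdot> a)"
      using zc[OF ax(1)] by (simp_all add: y(2) flip: mult_assoc)
    then show "a \<cdot> x \<in> (\<lambda>a. z \<cdot> a) ` A" "x \<cdot> a \<in> (\<lambda>a. z \<cdot> a) ` A" using ax y by auto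
  qed
  have id: "e \<cdot> a = a \<and> a \<cdot> e = a" if "a \<in> A" for a
  proof -
    from that * obtain b where b: "b \<in> A" "a = z \<cdot> b" by auto
    have "e \<cdot> a = a" using e(2) by (simp add: b(2) flip: mult_assoc)
    moreover have "a \<cdot> e = a" using e(3) zc[OF b(1)] by (simp add: b(2) mult_assoc)
    ultimately show ?thesis by simp
  qed
  from e(1) * obtain w where w: "w \<in> A" "e = z \<cdot> w" by auto
  have wc: "w \<cdot> a = a \<cdot> w" if "a \<in> A" for a
  proof -
    have "w \<cdot> a = w \<cdot> (a \<cdot> (z \<cdot> w))" using id[of "a"] that by (simp flip: w(2))
    also have "\<dots> = z \<cdot> w \<cdot> a \<cdot> w"
      using zc[OF that] zc[OF w(1)] by (metis mult_assoc)
    also have "\<dots> = a \<cdot> w" using id that by (simp flip: w(2))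
    finally show ?thesis .
  qed
  have "commutators \<subseteq> {x. w \<cdot> x \<in> commutators}"
  proof (rule commutators_least)
    show "subspace {x. w \<cdot> x \<in> commutators}"
      using subspace_commutators unfolding subspace_def by (simp add: mult_simps)
    fix x y assume xy: "x \<in> A" "y \<in> A"
    have "w \<cdot> bracket x y = bracket (w \<cdot> x) y"
      using wc[OF xy(2)] by (simp add: commutator_def mult_simps flip: mult_assoc)
    then show "bracket x y \<in> {x. w \<cdot> x \<in> commutators}" using xy w by auto
  qed
  then have "w \<cdot> z \<in> commutators" using z by auto
  then have "e \<in> commutators" using wc[OF zA] w(2) by simp
  with id e(1) that show thesis by (auto simp: identity_def)
qed

theorem simple_lie_algebra_three_idempotents:
  assumes pqr: "orthogonal_idempotents p q r"
    and no_identity: "\<And>e. identity e \<Longrightarrow> e \<notin> commutators"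
  shows "simple_lie_algebra scale bracket commutators"
proof -
  note [simp] = orthogonal_idempotentsD[OF pqr]
  obtain a where a: "a \<in> A" "p \<cdot> a \<cdot> q \<noteq> 0" using prime_product[of p q] by auto
  obtain b where b: "b \<in> A" "p \<cdot> a \<cdot> q \<cdot> b \<cdot> r \<noteq> 0" using prime_product[of "p \<cdot> a \<cdot> q" r] a by auto
  show ?thesis
  proof (rule simple_lie_algebra_commutatorsI)
    fix U assume U: "lie_ideal U" "U \<subseteq> commutators" "U \<noteq> {0}"
    moreover have "0 \<in> U" using lie_idealD(1)[OF U(1)] by (rule subspace_0)
    ultimately obtain u where u: "u \<in> U" "u \<noteq> 0" by auto
    then have "\<not> central u"
      using identity_of_central_commutator[of u] no_identity U by blast
    then show "commutators \<subseteq> U" using lie_ideal_central_or_contains_commutators[OF pqr U(1)] u by auto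
  next
    show "p \<cdot> a \<cdot> q \<in> commutators" "q \<cdot> b \<cdot> r \<in> commutators"
      using a b by (auto intro!: corner_in_commutators)
    show "bracket (p \<cdot> a \<cdot> q) (q \<cdot> b \<cdot> r) \<noteq> 0"
      using b by (simp add: commutator_def mult_assoc)
  qed
qed

section \<open>Two-by-two matrices\<close>

text \<open>
  Primeness gives \<open>x\<close> and \<open>y\<close> in opposite corners with \<open>xy \<noteq> 0\<close>, which can be scaled to \<open>xy = e\<close>. Then \<open>yx\<close>
  is a nonzero idempotent multiple of \<open>e'\<close> and hence equal to \<open>e'\<close>.
\<close>
lemma scalar_corners_matrix_units:
  assumes e: "e \<in> A" "e' \<in> A" "e \<noteq> 0" "e' \<noteq> 0" "e \<cdot> e = e" "e' \<cdot> e' = e'"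
    and scalar: "\<And>a. a \<in> A \<Longrightarrow> \<exists>c. e \<cdot> a \<cdot> e = c \<odot> e" "\<And>a. a \<in> A \<Longrightarrow> \<exists>c. e' \<cdot> a \<cdot> e' = c \<odot> e'"
  obtains x y where "x \<in> A" "y \<in> A" "x = e \<cdot> x \<cdot> e'" "y = e' \<cdot> y \<cdot> e" "x \<cdot> y = e" "y \<cdot> x = e'"
proof -
  have ee: "e \<cdot> (e \<cdot> z) = e \<cdot> z" "e' \<cdot> (e' \<cdot> z) = e' \<cdot> z" for z using e by (simp_all flip: mult_assoc)
  obtain a where a: "a \<in> A" "e \<cdot> a \<cdot> e' \<noteq> 0" using prime_product[of e e'] e by auto
  obtain b where b: "b \<in> A" "e \<cdot> a \<cdot> e' \<cdot> b \<cdot> e \<noteq> 0" using prime_product[of "e \<cdot> a \<cdot> e'" e] a e by auto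
  obtain c where c: "e \<cdot> (a \<cdot> e' \<cdot> b) \<cdot> e = c \<odot> e" using scalar(1)[of "a \<cdot> e' \<cdot> b"] a b e by auto
  with b have "c \<noteq> 0" by (auto simp: mult_assoc)
  define x where "x = e \<cdot> a \<cdot> e'"
  define y where "y = inverse c \<odot> (e' \<cdot> b \<cdot> e)"
  have xy: "x \<cdot> y = e"
    using c \<open>c \<noteq> 0\<close> by (simp add: x_def y_def mult_assoc mult_scale_right ee)
  have x: "x \<in> A" "x = e \<cdot> x \<cdot> e'" and y: "y \<in> A" "y = e' \<cdot> y \<cdot> e"
    using e a b by (auto simp: x_def y_def mult_simps ee)
  have ex: "e \<cdot> x = x" "x \<cdot> e' = x" "e' \<cdot> y = y" "y \<cdot> e = y"
    using e by (simp_all add: x_def y_def mult_simps ee)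
  have "e' \<cdot> (y \<cdot> x) \<cdot> e' = y \<cdot> x" by (simp add: mult_assoc ex) (simp add: ex flip: mult_assoc)
  then obtain d where d: "y \<cdot> x = d \<odot> e'"
    using scalar(2)[of "y \<cdot> x"] x y by auto
  have "y \<cdot> x \<cdot> (y \<cdot> x) = y \<cdot> (x \<cdot> y) \<cdot> x" by (simp add: mult_assoc)
  also have "\<dots> = y \<cdot> x" by (simp add: xy ex)
  finally have "(d * d) \<odot> e' = d \<odot> e'" by (simp add: d mult_simps e)
  then have "d * d = d" using e by simp
  moreover have "d \<noteq> 0"
  proof
    assume "d = 0"
    then have "x \<cdot> (y \<cdot> x) \<cdot> y = 0" by (simp add: d)
    moreover have "x \<cdot> (y \<cdot> x) \<cdot> y = (x \<cdot> y) \<cdot> (x \<cdot> y)" by (simp add: mult_assoc)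
    ultimately show False using e xy by simp
  qed
  ultimately have "y \<cdot> x = e'" by (simp add: d)
  with that x y xy show thesis by blast
qed

text \<open>
  Here \<open>A\<close> has the basis \<open>e, e', x, y\<close> of matrix units and \<open>[A, A]\<close> is spanned by \<open>h = e - e'\<close>, \<open>x\<close> and \<open>y\<close>.
  If \<open>2 = 0\<close>, then \<open>e + e' = h = [x, y]\<close>, against the hypothesis on the identity; so \<open>2\<close> is invertible
  and the classical argument for trace zero matrices applies.
\<close>
theorem simple_lie_algebra_two_by_two:
  assumes e: "e \<in> A" "e' \<in> A" "e \<noteq> 0" "e' \<noteq> 0" "e \<cdot> e = e" "e' \<cdot> e' = e'" "e \<cdot> e' = 0" "e' \<cdot> e = 0"
    and one: "identity (e + e')" "e + e' \<notin> commutators"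
    and scalar: "\<And>a. a \<in> A \<Longrightarrow> \<exists>c. e \<cdot> a \<cdot> e = c \<odot> e" "\<And>a. a \<in> A \<Longrightarrow> \<exists>c. e' \<cdot> a \<cdot> e' = c \<odot> e'"
  shows "simple_lie_algebra scale bracket commutators"
proof -
  obtain x y where xy: "x \<in> A" "y \<in> A" "x = e \<cdot> x \<cdot> e'" "y = e' \<cdot> y \<cdot> e" "x \<cdot> y = e" "y \<cdot> x = e'"
    using scalar_corners_matrix_units[OF e(1-6) scalar] by blast
  have ee: "e \<cdot> (e \<cdot> z) = e \<cdot> z" "e' \<cdot> (e' \<cdot> z) = e' \<cdot> z" "e \<cdot> (e' \<cdot> z) = 0" "e' \<cdot> (e \<cdot> z) = 0" for z
    using e by (simp_all flip: mult_assoc)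
  have "e \<cdot> (e \<cdot> x \<cdot> e') = e \<cdot> x \<cdot> e'" "e \<cdot> x \<cdot> e' \<cdot> e' = e \<cdot> x \<cdot> e'"
    "e' \<cdot> (e \<cdot> x \<cdot> e') = 0" "e \<cdot> x \<cdot> e' \<cdot> e = 0"
    "e' \<cdot> (e' \<cdot> y \<cdot> e) = e' \<cdot> y \<cdot> e" "e' \<cdot> y \<cdot> e \<cdot> e = e' \<cdot> y \<cdot> e"
    "e \<cdot> (e' \<cdot> y \<cdot> e) = 0" "e' \<cdot> y \<cdot> e \<cdot> e' = 0"
    by (simp_all add: mult_assoc ee e)
  then have table: "e \<cdot> x = x" "x \<cdot> e' = x" "e' \<cdot> x = 0" "x \<cdot> e = 0"
    "e' \<cdot> y = y" "y \<cdot> e = y" "e \<cdot> y = 0" "y \<cdot> e' = 0"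
    unfolding xy(3,4)[symmetric] by simp_all
  have "x \<cdot> x = x \<cdot> e' \<cdot> (e \<cdot> x)" "y \<cdot> y = y \<cdot> e \<cdot> (e' \<cdot> y)" by (simp_all add: table)
  then have sq: "x \<cdot> x = 0" "y \<cdot> y = 0" by (simp_all add: mult_assoc ee)
  note table = table sq xy(5,6) e(5-8)
  define h where "h = e - e'"
  have h: "bracket x y = h" by (simp add: commutator_def h_def table)
  have decomp: "\<exists>\<alpha> \<beta> \<gamma> \<delta>. a = \<alpha> \<odot> e + \<beta> \<odot> e' + \<gamma> \<odot> x + \<delta> \<odot> y" if "a \<in> A" for a
  proof -
    obtain \<alpha> \<beta> where "e \<cdot> a \<cdot> e = \<alpha> \<odot> e" "e' \<cdot> a \<cdot> e' = \<beta> \<odot> e'" using scalar[OF \<open>a \<in> A\<close>] by blast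
    moreover obtain \<gamma> where g: "e \<cdot> (a \<cdot> y) \<cdot> e = \<gamma> \<odot> e" using scalar(1)[of "a \<cdot> y"] \<open>a \<in> A\<close> xy(1,2) by auto
    from arg_cong[OF g, of "\<lambda>z. z \<cdot> x"] have "e \<cdot> a \<cdot> e' = \<gamma> \<odot> x"
      by (simp add: mult_simps table)
    moreover obtain \<delta> where g: "e' \<cdot> (a \<cdot> x) \<cdot> e' = \<delta> \<odot> e'" using scalar(2)[of "a \<cdot> x"] \<open>a \<in> A\<close> xy(1,2) by auto
    from arg_cong[OF g, of "\<lambda>z. z \<cdot> y"] have "e' \<cdot> a \<cdot> e = \<delta> \<odot> y"
      by (simp add: mult_simps table)
    moreover have "a = (e + e') \<cdot> a \<cdot> (e + e')" using one(1) \<open>a \<in> A\<close> by (simp add: identity_def)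
    then have "a = e \<cdot> a \<cdot> e + e' \<cdot> a \<cdot> e' + e \<cdot> a \<cdot> e' + e' \<cdot> a \<cdot> e"
      by (simp add: mult_simps ac_simps)
    ultimately have "a = \<alpha> \<odot> e + \<beta> \<odot> e' + \<gamma> \<odot> x + \<delta> \<odot> y" by simp
    then show ?thesis by blast
  qed
  define M where "M = {\<alpha> \<odot> h + \<gamma> \<odot> x + \<delta> \<odot> y | \<alpha> \<gamma> \<delta>. True}"
  have M: "commutators \<subseteq> M"
  proof (rule commutators_least)
    have MI: "u \<in> M" if "u = \<alpha> \<odot> h + \<gamma> \<odot> x + \<delta> \<odot> y" for u \<alpha> \<gamma> \<delta>
      using that unfolding M_def by blast
    show "subspace M" unfolding subspace_def
    proof (intro conjI ballI allI)
      show "0 \<in> M" by (rule MI[of _ 0 0 0]) simp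
    next
      fix u v assume "u \<in> M" "v \<in> M"
      then obtain a b c a' b' c' where "u = a \<odot> h + b \<odot> x + c \<odot> y" "v = a' \<odot> h + b' \<odot> x + c' \<odot> y"
        unfolding M_def by blast
      then show "u + v \<in> M"
        by (intro MI[of _ "a + a'" "b + b'" "c + c'"]) (simp add: scale_left_distrib)
    next
      fix k u assume "u \<in> M"
      then obtain a b c where "u = a \<odot> h + b \<odot> x + c \<odot> y" unfolding M_def by blast
      then show "k \<odot> u \<in> M"
        by (intro MI[of _ "k * a" "k * b" "k * c"]) (simp add: scale_right_distrib)
    qed
    fix u v assume "u \<in> A" "v \<in> A"
    then obtain a b c d a' b' c' d' where
      uv: "u = a \<odot> e + b \<odot> e' + c \<odot> x + d \<odot> y" "v = a' \<odot> e + b' \<odot> e' + c' \<odot> x + d' \<odot> y"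
      using decomp[of u] decomp[of v] by blast
    have "bracket u v = (c * d' - c' * d) \<odot> h + (a * c' + c * b' - a' * c - c' * b) \<odot> x
        + (b * d' + d * a' - b' * d - d' * a) \<odot> y"
      unfolding commutator_def uv h_def
      by (simp add: mult_simps table scale_left_distrib scale_left_diff_distrib scale_right_distrib
          scale_right_diff_distrib algebra_simps)
    then show "bracket u v \<in> M" by (rule MI)
  qed
  have two: "(2 :: 'a) \<noteq> 0"
  proof
    assume two: "(2 :: 'a) = 0"
    have "e + e' = h + (2 :: 'a) \<odot> e'" using scale_left_distrib[of 1 1 e'] by (simp add: h_def)
    then have "e + e' = bracket x y" by (simp add: two h)
    with one(2) xy(1,2) show False by auto
  qed
  have xL: "x \<in> commutators" and yL: "y \<in> commutators"
    using corner_in_commutators[of e x e'] corner_in_commutators[of e' y e] e xy(1,2) unfolding xy(3,4)[symmetric] by auto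
  have br: "bracket h x = (2 :: 'a) \<odot> x" "bracket y h = (2 :: 'a) \<odot> y"
    using scale_left_distrib[of 1 1 x] scale_left_distrib[of 1 1 y]
    by (simp_all add: commutator_def h_def mult_simps table)
  have hL: "h \<in> commutators" unfolding h[symmetric] using xy(1,2) by auto
  show ?thesis
  proof (rule simple_lie_algebra_commutatorsI[OF _ xL yL])
    have "h \<cdot> e = e" by (simp add: h_def mult_simps table)
    then show "bracket x y \<noteq> 0" using h e(3) by auto
    fix U assume U: "lie_ideal U" "U \<subseteq> commutators" "U \<noteq> {0}"
    note D = lie_idealD[OF U(1)]
    have cancel: "z \<in> U" if "c \<odot> z \<in> U" "c \<noteq> 0" for c z
      using subspace_scale[OF D(1) that(1), of "inverse c"] that(2) by simp
    have xU: "z \<in> U" if "x \<in> U" "z \<in> {h, y}" for z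
    proof -
      have "h \<in> U" using D(4)[OF yL \<open>x \<in> U\<close>] h by simp
      moreover have "(2 :: 'a) \<odot> y \<in> U" using D(3)[OF yL \<open>h \<in> U\<close>] by (simp add: br)
      ultimately show ?thesis using that(2) cancel[OF _ two] by auto
    qed
    have yU: "x \<in> U" if "y \<in> U"
    proof -
      have "h \<in> U" using D(3)[OF xL \<open>y \<in> U\<close>] h by simp
      then have "(2 :: 'a) \<odot> x \<in> U" using D(4)[OF xL] by (simp flip: br)
      then show ?thesis using cancel[OF _ two] by auto
    qed
    have "0 \<in> U" using D(1) by (rule subspace_0)
    with U obtain u where u: "u \<in> U" "u \<noteq> 0" by auto
    with U M obtain a b c where abc: "u = a \<odot> h + b \<odot> x + c \<odot> y" unfolding M_def by blast
    have "x \<in> U"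
    proof (cases "b = 0 \<and> c = 0")
      case True
      then have "h \<in> U" using abc u cancel[of a h] by auto
      then have "(2 :: 'a) \<odot> x \<in> U" using D(4)[OF xL] by (simp flip: br)
      then show ?thesis using cancel[OF _ two] by auto
    next
      case False
      have "bracket x (bracket x u) = (- 2 * c) \<odot> x" "bracket y (bracket y u) = (- 2 * b) \<odot> y"
        unfolding commutator_def abc h_def
        by (simp_all add: mult_simps table scale_left_distrib scale_left_diff_distrib scale_right_distrib
          scale_right_diff_distrib algebra_simps)
         (simp_all only: mult_2_right scale_left_distrib)
      then have "(- 2 * c) \<odot> x \<in> U" "(- 2 * b) \<odot> y \<in> U"
        using D(3)[OF xL D(3)[OF xL u(1)]] D(3)[OF yL D(3)[OF yL u(1)]] by simp_all
      then show ?thesis using False cancel[of "- 2 * c" x] cancel[of "- 2 * b" y] two yU by auto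
    qed
    with xU have "x \<in> U" "y \<in> U" "h \<in> U" by auto
    then have "M \<subseteq> U"
      unfolding M_def using D(1) by (auto intro!: subspace_add subspace_scale)
    with M show "commutators \<subseteq> U" by auto
  qed
qed

end

section \<open>Changing a product outside a subspace\<close>

text \<open>
  A product that is bilinear and associative only on a subspace \<open>A\<close> becomes so everywhere after
  both arguments are projected to \<open>A\<close>. Simplicity of \<open>A\<close> and of its Lie algebra depend only on the
  values on \<open>A\<close>.
\<close>
lemma (in vector_space) exists_linear_projection:
  assumes "subspace A"
  obtains \<pi> where "\<And>x. \<pi> x \<in> A" "\<And>x. x \<in> A \<Longrightarrow> \<pi> x = x" "\<And>x y. \<pi> (x + y) = \<pi> x + \<pi> y"
    "\<And>c x. \<pi> (scale c x) = scale c (\<pi> x)"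
proof -
  interpret vector_space_pair scale scale ..
  obtain \<pi> where \<pi>: "range \<pi> \<subseteq> A" "Vector_Spaces.linear scale scale \<pi>" "\<forall>v\<in>A. \<pi> (id v) = v"
    using linear_exists_left_inverse_on[OF linear_id assms inj_on_id] by blast
  interpret Vector_Spaces.linear scale scale \<pi> by fact
  show thesis
  proof (rule that)
    show "\<pi> x \<in> A" for x using \<pi>(1) by auto
    show "\<pi> x = x" if "x \<in> A" for x using \<pi>(3) that by auto
  qed (auto simp: add scale)
qed

lemma product_span_cong:
  assumes "\<And>x y. x \<in> A \<Longrightarrow> y \<in> A \<Longrightarrow> mu x y = nu x y"
  shows "product_span sc mu A = product_span sc nu A"
proof -
  have "{mu x y |x y. x \<in> A \<and> y \<in> A} = {nu x y |x y. x \<in> A \<and> y \<in> A}"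
    by (intro Collect_cong ex_cong1) (auto simp: assms)
  then show ?thesis by (simp add: product_span_def)
qed

lemma simple_algebra_cong_imp:
  assumes eq: "\<And>x y. x \<in> A \<Longrightarrow> y \<in> A \<Longrightarrow> mu x y = nu x y" and simple: "simple_algebra sc mu A"
  shows "simple_algebra sc nu A"
  unfolding simple_algebra_def
proof (intro conjI allI impI; (elim conjE)?)
  have "product_span sc mu A = product_span sc nu A" by (rule product_span_cong) (rule eq)
  then show "product_span sc nu A \<noteq> {0}" using simple by (simp add: simple_algebra_def)
  fix I assume I: "module.subspace sc I" "I \<subseteq> A" "\<forall>a\<in>A. \<forall>x\<in>I. nu a x \<in> I \<and> nu x a \<in> I"
  then have "\<forall>a\<in>A. \<forall>x\<in>I. mu a x \<in> I \<and> mu x a \<in> I" by (simp add: eq subset_iff)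
  then show "I = {0} \<or> I = A" using simple I(1,2) unfolding simple_algebra_def by blast
qed

lemma simple_lie_algebra_cong_imp:
  assumes "\<And>x y. x \<in> L \<Longrightarrow> y \<in> L \<Longrightarrow> b x y = b' x y" and "simple_lie_algebra sc b L"
  shows "simple_lie_algebra sc b' L"
proof -
  interpret simple_lie_algebra sc b L by fact
  have eq: "b' x y = b x y" if "x \<in> L" "y \<in> L" for x y
    using assms(1) that by simp
  have [simp]: "x + y \<in> L" if "x \<in> L" "y \<in> L" for x y
    using that subspace by (auto intro: subspace_add)
  have [simp]: "sc c x \<in> L" if "x \<in> L" for x c
    using that subspace by (auto intro: subspace_scale)
  show ?thesis
  proof unfold_locales
    show "subspace L" by (rule subspace)
    show "product_span sc b' L \<noteq> {0}"
      using nonabelian product_span_cong[of L b' b sc] eq by simp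
    fix I assume I: "subspace I" "I \<subseteq> L" "\<forall>a\<in>L. \<forall>x\<in>I. b' a x \<in> I"
    then have "\<forall>a\<in>L. \<forall>x\<in>I. b a x \<in> I" by (simp add: eq subset_iff)
    then show "I = {0} \<or> I = L" using lie_ideals I by blast
  qed (simp_all add: eq bracket_closed bracket_add_left bracket_add_right bracket_scale_left bracket_scale_right
      bracket_self jacobi)
qed

lemma simple_lie_algebra_cong:
  assumes "\<And>x y. x \<in> L \<Longrightarrow> y \<in> L \<Longrightarrow> b x y = b' x y"
  shows "simple_lie_algebra sc b L \<longleftrightarrow> simple_lie_algebra sc b' L"
  by (intro iffI; erule simple_lie_algebra_cong_imp[rotated]) (simp_all only: assms)

section \<open>Groupoids and convolution\<close>

context groupoid
begin

abbreviation gm (infixl "\<bullet>\<^sub>G" 70) where "x \<bullet>\<^sub>G y \<equiv> gmul G x y"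
abbreviation iv where "iv \<equiv> ginv G"
abbreviation src where "src \<equiv> gsrc G"
abbreviation rng where "rng \<equiv> grng G"

lemma composable_iff: "(x, y) \<in> composable G \<longleftrightarrow> x \<in> arrows G \<and> y \<in> arrows G \<and> src x = rng y"
  by (simp add: composable_def)

lemma src_inv [simp]: "x \<in> arrows G \<Longrightarrow> src (iv x) = rng x"
  by (simp add: gsrc_def grng_def inv_inv)

lemma rng_inv [simp]: "x \<in> arrows G \<Longrightarrow> rng (iv x) = src x"
  by (simp add: gsrc_def grng_def inv_inv)

lemma inv_mul_eq_src: "iv x \<bullet>\<^sub>G x = src x" and mul_inv_eq_rng: "x \<bullet>\<^sub>G iv x = rng x"
  by (simp_all add: gsrc_def grng_def)

lemma src_closed [simp]: "x \<in> arrows G \<Longrightarrow> src x \<in> arrows G"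
  by (metis composable_iff inv_closed inv_mul_eq_src mul_closed src_inv)

lemma rng_closed [simp]: "x \<in> arrows G \<Longrightarrow> rng x \<in> arrows G"
  by (metis inv_closed src_closed src_inv)

lemma src_src [simp]: "x \<in> arrows G \<Longrightarrow> src (src x) = src x"
  and rng_src [simp]: "x \<in> arrows G \<Longrightarrow> rng (src x) = src x"
  using src_mul[of "iv x" x] rng_mul[of "iv x" x]
  by (simp_all add: composable_iff inv_closed inv_mul_eq_src)

lemma src_rng [simp]: "x \<in> arrows G \<Longrightarrow> src (rng x) = rng x"
  and rng_rng [simp]: "x \<in> arrows G \<Longrightarrow> rng (rng x) = rng x"
  using src_src[of "iv x"] rng_src[of "iv x"] by (simp_all add: inv_closed)

lemma unitsD:
  assumes "u \<in> units G"
  shows "u \<in> arrows G" "src u = u" "rng u = u"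
  using assms by (auto simp: units_def)

lemma src_units [simp, intro]: "x \<in> arrows G \<Longrightarrow> src x \<in> units G"
  by (simp add: units_def)

lemma rng_units [simp, intro]: "x \<in> arrows G \<Longrightarrow> rng x \<in> units G"
  by (metis src_units src_rng rng_closed)

lemma inv_unit: "u \<in> units G \<Longrightarrow> iv u = u"
  using mul_src[of "iv u"] inv_mul_eq_src[of u] unitsD[of u] by (simp add: inv_closed)

lemma mul_cancel_left:
  assumes "(x, y) \<in> composable G"
  shows "iv x \<bullet>\<^sub>G (x \<bullet>\<^sub>G y) = y"
  using mul_assoc[of "iv x" x y] assms rng_mul_left[of y]
  by (simp add: composable_iff inv_closed inv_mul_eq_src)

lemma quotient_arrow:
  assumes "x \<in> arrows G" "z \<in> arrows G" "rng x = rng z"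
  shows "iv x \<bullet>\<^sub>G z \<in> arrows G" "rng (iv x \<bullet>\<^sub>G z) = src x" "src (iv x \<bullet>\<^sub>G z) = src z"
    "x \<bullet>\<^sub>G (iv x \<bullet>\<^sub>G z) = z" "(x, iv x \<bullet>\<^sub>G z) \<in> composable G"
proof -
  have c: "(iv x, z) \<in> composable G" using assms by (simp add: composable_iff inv_closed)
  show 1: "iv x \<bullet>\<^sub>G z \<in> arrows G" "rng (iv x \<bullet>\<^sub>G z) = src x" "src (iv x \<bullet>\<^sub>G z) = src z"
    using mul_closed[OF c] rng_mul[OF c] src_mul[OF c] assms by simp_all
  show "x \<bullet>\<^sub>G (iv x \<bullet>\<^sub>G z) = z"
    using mul_cancel_left[OF c] assms by (simp add: inv_inv)
  show "(x, iv x \<bullet>\<^sub>G z) \<in> composable G" using 1 assms by (simp add: composable_iff)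
qed

lemma quotient_unique:
  assumes "(x, y) \<in> composable G" "x \<bullet>\<^sub>G y = z"
  shows "y = iv x \<bullet>\<^sub>G z" "rng x = rng z" "src y = src z" "z \<in> arrows G"
  using assms mul_cancel_left[of x y] rng_mul[of x y] src_mul[of x y] mul_closed[of x y] by auto

lemma inv_mul_assoc:
  assumes "(x, y) \<in> composable G" "z \<in> arrows G" "rng x = rng z"
  shows "iv (x \<bullet>\<^sub>G y) \<bullet>\<^sub>G z = iv y \<bullet>\<^sub>G (iv x \<bullet>\<^sub>G z)"
proof -
  note q = quotient_arrow[of x z] and xy = assms(1)[unfolded composable_iff]
  note q' = quotient_arrow[of y "iv x \<bullet>\<^sub>G z"]
  have "x \<bullet>\<^sub>G y \<bullet>\<^sub>G (iv y \<bullet>\<^sub>G (iv x \<bullet>\<^sub>G z)) = z"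
    using mul_assoc[OF assms(1), of "iv y \<bullet>\<^sub>G (iv x \<bullet>\<^sub>G z)"] q q' assms xy by simp
  moreover have "(x \<bullet>\<^sub>G y, iv y \<bullet>\<^sub>G (iv x \<bullet>\<^sub>G z)) \<in> composable G"
    using q q' assms xy by (simp add: composable_iff mul_closed src_mul)
  ultimately show ?thesis using quotient_unique(1) by metis
qed

text \<open>
  Finiteness of the support on each fibre of the range map makes every convolution with \<open>f\<close> on the
  left a finite sum. The class is closed under convolution, so it carries an associative algebra,
  which contains the Steinberg algebra, and topology can be left aside.
\<close>
definition rng_finite :: "('g \<Rightarrow> 'k::field) \<Rightarrow> bool" where
  "rng_finite f \<longleftrightarrow> (\<forall>\<gamma>. f \<gamma> \<noteq> 0 \<longrightarrow> \<gamma> \<in> arrows G) \<and> (\<forall>u. finite {\<gamma>. f \<gamma> \<noteq> 0 \<and> rng \<gamma> = u})"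

lemma rng_finiteD:
  assumes "rng_finite f"
  shows "f \<gamma> \<noteq> 0 \<Longrightarrow> \<gamma> \<in> arrows G" "\<gamma> \<notin> arrows G \<Longrightarrow> f \<gamma> = 0"
    "finite {\<gamma>. f \<gamma> \<noteq> 0 \<and> rng \<gamma> = u}"
  using assms by (auto simp: rng_finite_def)

lemma convolution_outside:
  assumes "\<gamma> \<notin> arrows G"
  shows "convolution G f g \<gamma> = 0"
proof -
  have "\<not> ((\<alpha>, \<beta>) \<in> composable G \<and> \<alpha> \<bullet>\<^sub>G \<beta> = \<gamma> \<and> f \<alpha> \<noteq> 0 \<and> g \<beta> \<noteq> 0)" for \<alpha> \<beta>
    using mul_closed[of \<alpha> \<beta>] assms by metis
  then have "{(\<alpha>, \<beta>). (\<alpha>, \<beta>) \<in> composable G \<and> \<alpha> \<bullet>\<^sub>G \<beta> = \<gamma> \<and> f \<alpha> \<noteq> 0 \<and> g \<beta> \<noteq> 0} = {}"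
    by blast
  then show ?thesis unfolding convolution_def by (simp only: sum.empty)
qed

text \<open>
  The factorisations of \<open>\<gamma>\<close> are determined by their left factors, which range over the arrows with
  the range of \<open>\<gamma>\<close>. The index set may be any finite set of these that covers the support of \<open>f\<close>;
  this freedom allows different convolutions to be summed over the same set.
\<close>
lemma convolution_eq_sum:
  fixes f g :: "'g \<Rightarrow> 'k::field"
  assumes \<gamma>: "\<gamma> \<in> arrows G" and S: "finite S" "S \<subseteq> {\<alpha> \<in> arrows G. rng \<alpha> = rng \<gamma>}"
    "{\<alpha> \<in> arrows G. f \<alpha> \<noteq> 0 \<and> rng \<alpha> = rng \<gamma>} \<subseteq> S"
  shows "convolution G f g \<gamma> = (\<Sum>\<alpha>\<in>S. f \<alpha> * g (iv \<alpha> \<bullet>\<^sub>G \<gamma>))"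
proof -
  define S' where "S' = {\<alpha> \<in> S. f \<alpha> \<noteq> 0 \<and> g (iv \<alpha> \<bullet>\<^sub>G \<gamma>) \<noteq> 0}"
  have "{(\<alpha>, \<beta>). (\<alpha>, \<beta>) \<in> composable G \<and> \<alpha> \<bullet>\<^sub>G \<beta> = \<gamma> \<and> f \<alpha> \<noteq> 0 \<and> g \<beta> \<noteq> 0}
      = (\<lambda>\<alpha>. (\<alpha>, iv \<alpha> \<bullet>\<^sub>G \<gamma>)) ` S'" (is "?P = ?Q")
  proof (intro set_eqI iffI)
    fix p assume "p \<in> ?P"
    then obtain \<alpha> \<beta> where p: "p = (\<alpha>, \<beta>)" "(\<alpha>, \<beta>) \<in> composable G" "\<alpha> \<bullet>\<^sub>G \<beta> = \<gamma>" "f \<alpha> \<noteq> 0" "g \<beta> \<noteq> 0"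
      by auto
    note q = quotient_unique[OF p(2,3)]
    have "\<alpha> \<in> arrows G" using p(2) by (simp add: composable_iff)
    with p(4) q(2) have "\<alpha> \<in> S" using S(3) by auto
    moreover have "g (iv \<alpha> \<bullet>\<^sub>G \<gamma>) \<noteq> 0" using p(5) unfolding q(1) .
    ultimately have "\<alpha> \<in> S'" using p(4) by (simp add: S'_def)
    then show "p \<in> ?Q" unfolding p(1) by (subst q(1)) (rule imageI)
  next
    fix p assume "p \<in> ?Q"
    then obtain \<alpha> where "p = (\<alpha>, iv \<alpha> \<bullet>\<^sub>G \<gamma>)" "\<alpha> \<in> S'" by auto
    moreover from this have "\<alpha> \<in> arrows G" "rng \<alpha> = rng \<gamma>" using S(2) by (auto simp: S'_def)
    ultimately show "p \<in> ?P" using quotient_arrow(4,5)[of \<alpha> \<gamma>] \<gamma> by (simp add: S'_def)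
  qed
  then have "convolution G f g \<gamma> = (\<Sum>(\<alpha>, \<beta>)\<in>(\<lambda>\<alpha>. (\<alpha>, iv \<alpha> \<bullet>\<^sub>G \<gamma>)) ` S'. f \<alpha> * g \<beta>)"
    by (simp add: convolution_def)
  also have "\<dots> = (\<Sum>\<alpha>\<in>S'. f \<alpha> * g (iv \<alpha> \<bullet>\<^sub>G \<gamma>))"
    by (subst sum.reindex) (auto simp: inj_on_def)
  also have "\<dots> = (\<Sum>\<alpha>\<in>S. f \<alpha> * g (iv \<alpha> \<bullet>\<^sub>G \<gamma>))"
    using S(1) by (intro sum.mono_neutral_left) (auto simp: S'_def)
  finally show ?thesis .
qed

lemma convolution_eq_fibre_sum:
  assumes "rng_finite f" "\<gamma> \<in> arrows G"
  shows "convolution G f g \<gamma> = (\<Sum>\<alpha> | f \<alpha> \<noteq> 0 \<and> rng \<alpha> = rng \<gamma>. f \<alpha> * g (iv \<alpha> \<bullet>\<^sub>G \<gamma>))"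
  using assms by (intro convolution_eq_sum) (auto simp: rng_finite_def)

lemma rng_finite_zero: "rng_finite 0"
  by (simp add: rng_finite_def)

lemma rng_finite_add:
  assumes "rng_finite f" "rng_finite g"
  shows "rng_finite (f + g)"
  unfolding rng_finite_def
proof (intro conjI allI impI)
  show "\<gamma> \<in> arrows G" if "(f + g) \<gamma> \<noteq> 0" for \<gamma>
    using that rng_finiteD(2)[OF assms(1), of \<gamma>] rng_finiteD(2)[OF assms(2), of \<gamma>]
    by (cases "\<gamma> \<in> arrows G") auto
  show "finite {\<gamma>. (f + g) \<gamma> \<noteq> 0 \<and> rng \<gamma> = u}" for u
    by (rule finite_subset[of _ "{\<gamma>. f \<gamma> \<noteq> 0 \<and> rng \<gamma> = u} \<union> {\<gamma>. g \<gamma> \<noteq> 0 \<and> rng \<gamma> = u}"])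
      (auto simp: rng_finiteD(3) assms)
qed

lemma rng_finite_fscale:
  assumes "rng_finite f"
  shows "rng_finite (fscale c f)"
  unfolding rng_finite_def
proof (intro conjI allI impI)
  show "\<gamma> \<in> arrows G" if "fscale c f \<gamma> \<noteq> 0" for \<gamma>
    using that rng_finiteD(1)[OF assms, of \<gamma>] by (auto simp: fscale_def)
  show "finite {\<gamma>. fscale c f \<gamma> \<noteq> 0 \<and> rng \<gamma> = u}" for u
    by (rule finite_subset[OF _ rng_finiteD(3)[OF assms, of u]]) (auto simp: fscale_def)
qed

lemma rng_finite_convolution:
  assumes f: "rng_finite f" and g: "rng_finite g"
  shows "rng_finite (convolution G f g)"
  unfolding rng_finite_def
proof (intro conjI allI impI)
  show "\<gamma> \<in> arrows G" if "convolution G f g \<gamma> \<noteq> 0" for \<gamma>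
    using that convolution_outside by metis
  fix u
  define S where "S = {\<alpha>. f \<alpha> \<noteq> 0 \<and> rng \<alpha> = u}"
  define T where "T \<alpha> = {\<beta>. g \<beta> \<noteq> 0 \<and> rng \<beta> = src \<alpha>}" for \<alpha>
  have "{\<gamma>. convolution G f g \<gamma> \<noteq> 0 \<and> rng \<gamma> = u} \<subseteq> (\<Union>\<alpha>\<in>S. (\<lambda>\<beta>. \<alpha> \<bullet>\<^sub>G \<beta>) ` T \<alpha>)"
  proof
    fix \<gamma> assume "\<gamma> \<in> {\<gamma>. convolution G f g \<gamma> \<noteq> 0 \<and> rng \<gamma> = u}"
    then have \<gamma>: "convolution G f g \<gamma> \<noteq> 0" "rng \<gamma> = u" by auto
    then have "\<gamma> \<in> arrows G" using convolution_outside by metis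
    with \<gamma> f have "(\<Sum>\<alpha>\<in>S. f \<alpha> * g (iv \<alpha> \<bullet>\<^sub>G \<gamma>)) \<noteq> 0"
      by (simp add: convolution_eq_fibre_sum S_def)
    from sum.not_neutral_contains_not_neutral[OF this]
    obtain \<alpha> where \<alpha>: "\<alpha> \<in> S" "f \<alpha> * g (iv \<alpha> \<bullet>\<^sub>G \<gamma>) \<noteq> 0" by blast
    then have "\<alpha> \<in> arrows G" "rng \<alpha> = rng \<gamma>" using rng_finiteD(1)[OF f] \<gamma> by (auto simp: S_def)
    then have "iv \<alpha> \<bullet>\<^sub>G \<gamma> \<in> T \<alpha>" "\<gamma> = \<alpha> \<bullet>\<^sub>G (iv \<alpha> \<bullet>\<^sub>G \<gamma>)"
      using quotient_arrow(2,4)[of \<alpha> \<gamma>] \<open>\<gamma> \<in> arrows G\<close> \<alpha>(2) by (simp_all add: T_def)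
    with \<alpha> show "\<gamma> \<in> (\<Union>\<alpha>\<in>S. (\<lambda>\<beta>. \<alpha> \<bullet>\<^sub>G \<beta>) ` T \<alpha>)" by blast
  qed
  moreover have "finite (\<Union>\<alpha>\<in>S. (\<lambda>\<beta>. \<alpha> \<bullet>\<^sub>G \<beta>) ` T \<alpha>)"
    unfolding S_def T_def by (intro finite_UN_I finite_imageI rng_finiteD(3) f g)
  ultimately show "finite {\<gamma>. convolution G f g \<gamma> \<noteq> 0 \<and> rng \<gamma> = u}" by (rule finite_subset)
qed

lemma convolution_add_left:
  assumes f: "rng_finite f" and f': "rng_finite f'"
  shows "convolution G (f + f') g = convolution G f g + convolution G f' g"
proof
  fix \<gamma>
  show "convolution G (f + f') g \<gamma> = (convolution G f g + convolution G f' g) \<gamma>"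
  proof (cases "\<gamma> \<in> arrows G")
    case True
    define S where "S = {\<alpha>. f \<alpha> \<noteq> 0 \<and> rng \<alpha> = rng \<gamma>} \<union> {\<alpha>. f' \<alpha> \<noteq> 0 \<and> rng \<alpha> = rng \<gamma>}"
    have S: "finite S" "S \<subseteq> {\<alpha> \<in> arrows G. rng \<alpha> = rng \<gamma>}"
      using rng_finiteD(1,3)[OF f] rng_finiteD(1,3)[OF f'] by (auto simp: S_def)
    have "convolution G h g \<gamma> = (\<Sum>\<alpha>\<in>S. h \<alpha> * g (iv \<alpha> \<bullet>\<^sub>G \<gamma>))" if "h \<in> {f, f', f + f'}" for h
      using that by (intro convolution_eq_sum True S) (auto simp: S_def)
    then show ?thesis by (simp add: sum.distrib distrib_right)
  qed (simp add: convolution_outside)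
qed

lemma convolution_add_right:
  assumes f: "rng_finite f"
  shows "convolution G f (g + g') = convolution G f g + convolution G f g'"
proof
  fix \<gamma>
  show "convolution G f (g + g') \<gamma> = (convolution G f g + convolution G f g') \<gamma>"
    by (cases "\<gamma> \<in> arrows G")
      (simp_all add: convolution_outside convolution_eq_fibre_sum[OF f] sum.distrib distrib_left)
qed

lemma convolution_fscale_left:
  assumes f: "rng_finite f"
  shows "convolution G (fscale c f) g = fscale c (convolution G f g)"
proof
  fix \<gamma>
  show "convolution G (fscale c f) g \<gamma> = fscale c (convolution G f g) \<gamma>"
  proof (cases "\<gamma> \<in> arrows G")
    case True
    define S where "S = {\<alpha>. f \<alpha> \<noteq> 0 \<and> rng \<alpha> = rng \<gamma>}"
    have "convolution G h g \<gamma> = (\<Sum>\<alpha>\<in>S. h \<alpha> * g (iv \<alpha> \<bullet>\<^sub>G \<gamma>))" if "h \<in> {f, fscale c f}" for h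
      using that rng_finiteD(1,3)[OF f] by (intro convolution_eq_sum True) (auto simp: S_def fscale_def)
    then show ?thesis by (simp add: fscale_def sum_distrib_left mult.assoc)
  qed (simp add: convolution_outside fscale_def)
qed

lemma convolution_fscale_right:
  assumes f: "rng_finite f"
  shows "convolution G f (fscale c g) = fscale c (convolution G f g)"
proof
  fix \<gamma>
  show "convolution G f (fscale c g) \<gamma> = fscale c (convolution G f g) \<gamma>"
    by (cases "\<gamma> \<in> arrows G")
      (simp_all add: convolution_outside convolution_eq_fibre_sum[OF f] fscale_def sum_distrib_left mult.left_commute)
qed

text \<open>
  Both sides are the sum of \<open>f \<beta> * g \<delta> * h \<epsilon>\<close> over \<open>\<beta>\<delta>\<epsilon> = \<gamma>\<close>. The left side sums over \<open>\<alpha> = \<beta>\<delta>\<close> and \<open>\<beta>\<close>, and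
  the inner sums are matched by the bijection from \<open>\<alpha>\<close> to \<open>\<delta> = \<beta>\<^sup>-\<^sup>1\<alpha>\<close>.
\<close>
lemma convolution_assoc:
  assumes f: "rng_finite f" and g: "rng_finite g"
  shows "convolution G (convolution G f g) h = convolution G f (convolution G g h)"
proof
  fix \<gamma>
  show "convolution G (convolution G f g) h \<gamma> = convolution G f (convolution G g h) \<gamma>"
  proof (cases "\<gamma> \<in> arrows G")
    case \<gamma>: True
    define S where "S = {\<beta>. f \<beta> \<noteq> 0 \<and> rng \<beta> = rng \<gamma>}"
    define T where "T \<beta> = {\<delta>. g \<delta> \<noteq> 0 \<and> rng \<delta> = src \<beta>}" for \<beta>
    \<comment> \<open>The first part covers the support of \<open>f * g\<close>; the second makes the translates cover that of \<open>g\<close>.\<close>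
    define S' where "S' = {\<alpha>. convolution G f g \<alpha> \<noteq> 0 \<and> rng \<alpha> = rng \<gamma>} \<union> (\<Union>\<beta>\<in>S. (\<lambda>\<delta>. \<beta> \<bullet>\<^sub>G \<delta>) ` T \<beta>)"
    have S: "\<beta> \<in> arrows G" "rng \<beta> = rng \<gamma>" if "\<beta> \<in> S" for \<beta>
      using that rng_finiteD(1)[OF f] by (auto simp: S_def)
    have T: "(\<beta>, \<delta>) \<in> composable G" if "\<beta> \<in> S" "\<delta> \<in> T \<beta>" for \<beta> \<delta>
      using that S rng_finiteD(1)[OF g] by (auto simp: T_def composable_iff)
    have "finite S'"
      unfolding S'_def S_def T_def
      by (intro finite_UnI finite_UN_I finite_imageI rng_finiteD(3) rng_finite_convolution f g)
    have S': "\<alpha> \<in> arrows G" "rng \<alpha> = rng \<gamma>" if "\<alpha> \<in> S'" for \<alpha>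
    proof -
      from that consider "convolution G f g \<alpha> \<noteq> 0" "rng \<alpha> = rng \<gamma>"
        | \<beta> \<delta> where "\<beta> \<in> S" "\<delta> \<in> T \<beta>" "\<alpha> = \<beta> \<bullet>\<^sub>G \<delta>"
        unfolding S'_def by blast
      then have "\<alpha> \<in> arrows G \<and> rng \<alpha> = rng \<gamma>"
      proof cases
        case 1
        then show ?thesis using rng_finiteD(1)[OF rng_finite_convolution[OF f g]] by blast
      next
        case 2
        then show ?thesis
          using mul_closed[OF T[OF 2(1,2)]] rng_mul[OF T[OF 2(1,2)]] S[OF 2(1)] by simp
      qed
      then show "\<alpha> \<in> arrows G" "rng \<alpha> = rng \<gamma>" by auto
    qed
    have "convolution G (convolution G f g) h \<gamma> = (\<Sum>\<alpha>\<in>S'. convolution G f g \<alpha> * h (iv \<alpha> \<bullet>\<^sub>G \<gamma>))"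
    proof (rule convolution_eq_sum[OF \<gamma> \<open>finite S'\<close>])
      show "S' \<subseteq> {\<alpha> \<in> arrows G. rng \<alpha> = rng \<gamma>}" using S' by blast
      show "{\<alpha> \<in> arrows G. convolution G f g \<alpha> \<noteq> 0 \<and> rng \<alpha> = rng \<gamma>} \<subseteq> S'"
        unfolding S'_def by blast
    qed
    also have "\<dots> = (\<Sum>\<alpha>\<in>S'. \<Sum>\<beta>\<in>S. f \<beta> * (g (iv \<beta> \<bullet>\<^sub>G \<alpha>) * h (iv \<alpha> \<bullet>\<^sub>G \<gamma>)))"
    proof (rule sum.cong[OF refl])
      fix \<alpha> assume "\<alpha> \<in> S'"
      then have "convolution G f g \<alpha> = (\<Sum>\<beta>\<in>S. f \<beta> * g (iv \<beta> \<bullet>\<^sub>G \<alpha>))"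
        using convolution_eq_fibre_sum[OF f S'(1), of \<alpha> g] S'(2)[of \<alpha>] by (simp only: S_def)
      then show "convolution G f g \<alpha> * h (iv \<alpha> \<bullet>\<^sub>G \<gamma>)
          = (\<Sum>\<beta>\<in>S. f \<beta> * (g (iv \<beta> \<bullet>\<^sub>G \<alpha>) * h (iv \<alpha> \<bullet>\<^sub>G \<gamma>)))"
        by (simp add: sum_distrib_right mult.assoc)
    qed
    also have "\<dots> = (\<Sum>\<beta>\<in>S. f \<beta> * (\<Sum>\<alpha>\<in>S'. g (iv \<beta> \<bullet>\<^sub>G \<alpha>) * h (iv \<alpha> \<bullet>\<^sub>G \<gamma>)))"
      by (subst sum.swap) (simp add: sum_distrib_left)
    also have "\<dots> = (\<Sum>\<beta>\<in>S. f \<beta> * convolution G g h (iv \<beta> \<bullet>\<^sub>G \<gamma>))"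
    proof (intro sum.cong refl)
      fix \<beta> assume \<beta>: "\<beta> \<in> S"
      have q: "iv \<beta> \<bullet>\<^sub>G \<alpha> \<in> arrows G" "rng (iv \<beta> \<bullet>\<^sub>G \<alpha>) = src \<beta>" "\<beta> \<bullet>\<^sub>G (iv \<beta> \<bullet>\<^sub>G \<alpha>) = \<alpha>"
        "(\<beta>, iv \<beta> \<bullet>\<^sub>G \<alpha>) \<in> composable G" if "\<alpha> \<in> S'" for \<alpha>
        using quotient_arrow[of \<beta> \<alpha>] S[OF \<beta>] S'[OF that] by simp_all
      have inj: "inj_on (\<lambda>\<alpha>. iv \<beta> \<bullet>\<^sub>G \<alpha>) S'"
        by (rule inj_on_inverseI[of _ "\<lambda>\<delta>. \<beta> \<bullet>\<^sub>G \<delta>"]) (rule q(3))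
      have "convolution G g h (iv \<beta> \<bullet>\<^sub>G \<gamma>)
          = (\<Sum>\<delta>\<in>(\<lambda>\<alpha>. iv \<beta> \<bullet>\<^sub>G \<alpha>) ` S'. g \<delta> * h (iv \<delta> \<bullet>\<^sub>G (iv \<beta> \<bullet>\<^sub>G \<gamma>)))"
      proof (rule convolution_eq_sum)
        show "iv \<beta> \<bullet>\<^sub>G \<gamma> \<in> arrows G" using quotient_arrow[of \<beta> \<gamma>] S[OF \<beta>] \<gamma> by auto
        have r: "rng (iv \<beta> \<bullet>\<^sub>G \<gamma>) = src \<beta>" using quotient_arrow[of \<beta> \<gamma>] S[OF \<beta>] \<gamma> by auto
        show "finite ((\<lambda>\<alpha>. iv \<beta> \<bullet>\<^sub>G \<alpha>) ` S')" using \<open>finite S'\<close> by simp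
        show "(\<lambda>\<alpha>. iv \<beta> \<bullet>\<^sub>G \<alpha>) ` S' \<subseteq> {\<alpha> \<in> arrows G. rng \<alpha> = rng (iv \<beta> \<bullet>\<^sub>G \<gamma>)}"
          using q r by auto
        show "{\<alpha> \<in> arrows G. g \<alpha> \<noteq> 0 \<and> rng \<alpha> = rng (iv \<beta> \<bullet>\<^sub>G \<gamma>)} \<subseteq> (\<lambda>\<alpha>. iv \<beta> \<bullet>\<^sub>G \<alpha>) ` S'"
        proof
          fix \<delta> assume "\<delta> \<in> {\<alpha> \<in> arrows G. g \<alpha> \<noteq> 0 \<and> rng \<alpha> = rng (iv \<beta> \<bullet>\<^sub>G \<gamma>)}"
          then have \<delta>: "\<delta> \<in> T \<beta>" using r by (simp add: T_def)
          then have "\<beta> \<bullet>\<^sub>G \<delta> \<in> S'" using \<beta> unfolding S'_def by blast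
          moreover have "\<delta> = iv \<beta> \<bullet>\<^sub>G (\<beta> \<bullet>\<^sub>G \<delta>)" using mul_cancel_left[OF T[OF \<beta> \<delta>]] by (rule sym)
          ultimately show "\<delta> \<in> (\<lambda>\<alpha>. iv \<beta> \<bullet>\<^sub>G \<alpha>) ` S'" by (rule image_eqI[rotated])
        qed
      qed
      also have "\<dots> = (\<Sum>\<alpha>\<in>S'. g (iv \<beta> \<bullet>\<^sub>G \<alpha>) * h (iv (iv \<beta> \<bullet>\<^sub>G \<alpha>) \<bullet>\<^sub>G (iv \<beta> \<bullet>\<^sub>G \<gamma>)))"
        by (subst sum.reindex[OF inj]) simp
      also have "\<dots> = (\<Sum>\<alpha>\<in>S'. g (iv \<beta> \<bullet>\<^sub>G \<alpha>) * h (iv \<alpha> \<bullet>\<^sub>G \<gamma>))"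
      proof (rule sum.cong[OF refl])
        fix \<alpha> assume "\<alpha> \<in> S'"
        with inv_mul_assoc[OF q(4) \<gamma> S(2)[OF \<beta>], of \<alpha>]
        have "iv (iv \<beta> \<bullet>\<^sub>G \<alpha>) \<bullet>\<^sub>G (iv \<beta> \<bullet>\<^sub>G \<gamma>) = iv \<alpha> \<bullet>\<^sub>G \<gamma>" by (simp only: q(3))
        then show "g (iv \<beta> \<bullet>\<^sub>G \<alpha>) * h (iv (iv \<beta> \<bullet>\<^sub>G \<alpha>) \<bullet>\<^sub>G (iv \<beta> \<bullet>\<^sub>G \<gamma>))
            = g (iv \<beta> \<bullet>\<^sub>G \<alpha>) * h (iv \<alpha> \<bullet>\<^sub>G \<gamma>)" by (simp only:)
      qed
      finally show "f \<beta> * (\<Sum>\<alpha>\<in>S'. g (iv \<beta> \<bullet>\<^sub>G \<alpha>) * h (iv \<alpha> \<bullet>\<^sub>G \<gamma>)) = f \<beta> * convolution G g h (iv \<beta> \<bullet>\<^sub>G \<gamma>)"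
        by simp
    qed
    also have "\<dots> = convolution G f (convolution G g h) \<gamma>"
      by (simp add: convolution_eq_fibre_sum[OF f \<gamma>] S_def)
    finally show ?thesis .
  qed (simp add: convolution_outside)
qed

lemma sum_singleton: "(\<Sum>x\<in>{a}. h x) = h a"
  by simp

lemma convolution_units_left:
  assumes "W \<subseteq> units G" "rng_finite f"
  shows "convolution G (indicator W) f \<gamma> = indicator W (rng \<gamma>) * f \<gamma>"
proof (cases "\<gamma> \<in> arrows G")
  case True
  have "convolution G (indicator W) f \<gamma> = (\<Sum>\<alpha>\<in>{rng \<gamma>}. indicator W \<alpha> * f (iv \<alpha> \<bullet>\<^sub>G \<gamma>))"
    using True assms(1) unitsD by (intro convolution_eq_sum) (auto simp: indicator_def)
  also have "\<dots> = indicator W (rng \<gamma>) * f (iv (rng \<gamma>) \<bullet>\<^sub>G \<gamma>)"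
    by (simp only: sum_singleton)
  finally show ?thesis using True by (simp add: inv_unit rng_mul_left)
qed (simp add: convolution_outside rng_finiteD(2)[OF assms(2)])

lemma convolution_units_right:
  fixes f :: "'g \<Rightarrow> 'k::field"
  assumes W: "W \<subseteq> units G" and f: "rng_finite f"
  shows "convolution G f (indicator W) \<gamma> = f \<gamma> * indicator W (src \<gamma>)"
proof (cases "\<gamma> \<in> arrows G")
  case True
  define S where "S = insert \<gamma> {\<alpha>. f \<alpha> \<noteq> 0 \<and> rng \<alpha> = rng \<gamma>}"
  have S: "finite S" "S \<subseteq> {\<alpha> \<in> arrows G. rng \<alpha> = rng \<gamma>}"
    using rng_finiteD(1,3)[OF f] True by (auto simp: S_def)
  have zero: "indicator W (iv \<alpha> \<bullet>\<^sub>G \<gamma>) = (0::'k)" if "\<alpha> \<in> S - {\<gamma>}" for \<alpha>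
  proof -
    have \<alpha>: "\<alpha> \<in> arrows G" "rng \<alpha> = rng \<gamma>" "\<alpha> \<noteq> \<gamma>" using that S by auto
    note q = quotient_arrow[OF \<alpha>(1) True \<alpha>(2)]
    have "iv \<alpha> \<bullet>\<^sub>G \<gamma> \<notin> W"
    proof
      assume "iv \<alpha> \<bullet>\<^sub>G \<gamma> \<in> W"
      with W have "iv \<alpha> \<bullet>\<^sub>G \<gamma> \<in> units G" by auto
      with q(2) have "iv \<alpha> \<bullet>\<^sub>G \<gamma> = src \<alpha>" using unitsD(3) by auto
      with q(4) \<alpha> show False by (simp add: mul_src)
    qed
    then show ?thesis by simp
  qed
  have "convolution G f (indicator W) \<gamma> = (\<Sum>\<alpha>\<in>S. f \<alpha> * indicator W (iv \<alpha> \<bullet>\<^sub>G \<gamma>))"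
    by (intro convolution_eq_sum True S) (auto simp: S_def)
  also have "\<dots> = (\<Sum>\<alpha>\<in>{\<gamma>}. f \<alpha> * indicator W (iv \<alpha> \<bullet>\<^sub>G \<gamma>))"
    using S(1) zero by (intro sum.mono_neutral_right) (auto simp: S_def)
  also have "\<dots> = f \<gamma> * indicator W (iv \<gamma> \<bullet>\<^sub>G \<gamma>)" by (simp only: sum_singleton)
  finally show ?thesis by (simp add: inv_mul_eq_src)
qed (simp add: convolution_outside rng_finiteD(2)[OF assms(2)])

definition product_set :: "'g set \<Rightarrow> 'g set \<Rightarrow> 'g set" where
  "product_set U V = (\<lambda>(\<alpha>, \<beta>). \<alpha> \<bullet>\<^sub>G \<beta>) ` (U \<times> V \<inter> composable G)"

text \<open>
  If \<open>U\<close> has at most one arrow in each range fibre, then a product determines its left factor in \<open>U\<close>,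
  so the convolution sum has at most one nonzero term.
\<close>
lemma convolution_indicators:
  assumes U: "U \<subseteq> arrows G" "inj_on rng U" and V: "V \<subseteq> arrows G"
  shows "convolution G (indicator U) (indicator V) = (indicator (product_set U V) :: 'g \<Rightarrow> 'k::field)"
proof
  fix \<gamma>
  show "convolution G (indicator U) (indicator V) \<gamma> = (indicator (product_set U V) \<gamma> :: 'k)"
  proof (cases "\<gamma> \<in> arrows G")
    case True
    define S where "S = {\<alpha> \<in> U. rng \<alpha> = rng \<gamma>}"
    have S_eq: "S = {\<alpha>}" if "\<alpha> \<in> S" for \<alpha>
      using that U(2) by (auto simp: S_def inj_on_def)
    have "finite S" using S_eq by (metis finite.emptyI finite_insert ex_in_conv)
    then have *: "convolution G (indicator U) (indicator V) \<gamma>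
        = (\<Sum>\<alpha>\<in>S. indicator U \<alpha> * indicator V (iv \<alpha> \<bullet>\<^sub>G \<gamma>) :: 'k)"
      using U by (intro convolution_eq_sum True) (auto simp: S_def indicator_def)
    show ?thesis
    proof (cases "\<gamma> \<in> product_set U V")
      case True
      then obtain \<alpha> \<beta> where \<alpha>\<beta>: "\<alpha> \<in> U" "\<beta> \<in> V" "(\<alpha>, \<beta>) \<in> composable G" "\<alpha> \<bullet>\<^sub>G \<beta> = \<gamma>"
        by (auto simp: product_set_def)
      note q = quotient_unique[OF \<alpha>\<beta>(3,4)]
      have "\<alpha> \<in> S" using \<alpha>\<beta>(1) q(2) by (simp add: S_def)
      moreover have "iv \<alpha> \<bullet>\<^sub>G \<gamma> \<in> V" using \<alpha>\<beta>(2) unfolding q(1) .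
      ultimately have "S = {\<alpha>}" "iv \<alpha> \<bullet>\<^sub>G \<gamma> \<in> V" using S_eq by auto
      then show ?thesis unfolding * using True \<alpha>\<beta>(1) by simp
    next
      case False
      have "iv \<alpha> \<bullet>\<^sub>G \<gamma> \<notin> V" if "\<alpha> \<in> S" for \<alpha>
      proof
        assume "iv \<alpha> \<bullet>\<^sub>G \<gamma> \<in> V"
        moreover have \<alpha>: "\<alpha> \<in> U" "\<alpha> \<in> arrows G" "rng \<alpha> = rng \<gamma>" using that U by (auto simp: S_def)
        ultimately have "(\<alpha>, iv \<alpha> \<bullet>\<^sub>G \<gamma>) \<in> U \<times> V \<inter> composable G" "\<gamma> = \<alpha> \<bullet>\<^sub>G (iv \<alpha> \<bullet>\<^sub>G \<gamma>)"
          using quotient_arrow(4,5)[OF \<alpha>(2) True \<alpha>(3)] by simp_all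
        then have "(\<lambda>(\<alpha>, \<beta>). \<alpha> \<bullet>\<^sub>G \<beta>) (\<alpha>, iv \<alpha> \<bullet>\<^sub>G \<gamma>) \<in> product_set U V"
          unfolding product_set_def by (intro imageI)
        with quotient_arrow(4)[OF \<alpha>(2) True \<alpha>(3)] False show False by simp
      qed
      then show ?thesis unfolding * using False by simp
    qed
  next
    case False
    moreover have "product_set U V \<subseteq> arrows G" using mul_closed by (auto simp: product_set_def)
    ultimately show ?thesis by (auto simp: convolution_outside indicator_def)
  qed
qed

end

section \<open>The augmentation of an isotropy group\<close>

interpretation fscale: vector_space fscale
  by (rule vector_space_fscale)

lemma (in groupoid) rng_finite_indicator:
  assumes "U \<subseteq> arrows G" "inj_on rng U"
  shows "rng_finite (indicator U :: 'g \<Rightarrow> 'k::field)"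
  unfolding rng_finite_def
proof (intro conjI allI impI)
  show "\<gamma> \<in> arrows G" if "indicator U \<gamma> \<noteq> (0::'k)" for \<gamma>
    using that assms(1) by (auto simp: indicator_def split: if_splits)
  fix u
  define F where "F = {\<gamma>. indicator U \<gamma> \<noteq> (0::'k) \<and> rng \<gamma> = u}"
  have "F \<subseteq> {the_inv_into U rng u}"
    using assms(2) by (auto simp: F_def indicator_def the_inv_into_f_f split: if_splits)
  then show "finite F" by (rule finite_subset) simp
qed

definition (in groupoid) isotropy_sum :: "'g \<Rightarrow> ('g \<Rightarrow> 'k::field) \<Rightarrow> 'k" where
  "isotropy_sum u f = (\<Sum>\<gamma> | f \<gamma> \<noteq> 0 \<and> rng \<gamma> = u \<and> src \<gamma> = u. f \<gamma>)"

context groupoid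
begin

lemma isotropy_sum_eq:
  assumes "finite S" "{\<gamma>. f \<gamma> \<noteq> 0 \<and> rng \<gamma> = u \<and> src \<gamma> = u} \<subseteq> S" "\<And>\<gamma>. \<gamma> \<in> S \<Longrightarrow> rng \<gamma> = u \<and> src \<gamma> = u"
  shows "isotropy_sum u f = sum f S"
  unfolding isotropy_sum_def using assms by (intro sum.mono_neutral_left) auto

lemma finite_isotropy_support:
  assumes "rng_finite f"
  shows "finite {\<gamma>. f \<gamma> \<noteq> 0 \<and> rng \<gamma> = u \<and> src \<gamma> = u}"
  by (rule finite_subset[OF _ rng_finiteD(3)[OF assms, of u]]) auto

lemma isotropy_sum_add:
  assumes "rng_finite f" "rng_finite g"
  shows "isotropy_sum u (f + g) = isotropy_sum u f + isotropy_sum u g"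
proof -
  define S where "S = {\<gamma>. f \<gamma> \<noteq> 0 \<and> rng \<gamma> = u \<and> src \<gamma> = u} \<union> {\<gamma>. g \<gamma> \<noteq> 0 \<and> rng \<gamma> = u \<and> src \<gamma> = u}"
  have "finite S" unfolding S_def by (intro finite_UnI finite_isotropy_support assms)
  then have "isotropy_sum u h = sum h S" if "h \<in> {f, g, f + g}" for h
    using that by (intro isotropy_sum_eq) (auto simp: S_def)
  then show ?thesis by (simp add: sum.distrib)
qed

lemma isotropy_sum_fscale:
  assumes "rng_finite f"
  shows "isotropy_sum u (fscale c f) = c * isotropy_sum u f"
proof -
  have "isotropy_sum u (fscale c f) = sum (fscale c f) {\<gamma>. f \<gamma> \<noteq> 0 \<and> rng \<gamma> = u \<and> src \<gamma> = u}"
    using finite_isotropy_support[OF assms] by (intro isotropy_sum_eq) (auto simp: fscale_def)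
  then show ?thesis by (simp add: fscale_def isotropy_sum_def sum_distrib_left)
qed

text \<open>
  On functions supported in the isotropy group at \<open>u\<close>, convolution is the product of the group
  algebra and \<open>isotropy_sum\<close> is the augmentation, which is multiplicative because translation by a
  group element permutes the group.
\<close>
lemma isotropy_sum_convolution:
  fixes f g :: "'g \<Rightarrow> 'k::field"
  assumes u: "u \<in> units G" and f: "rng_finite f" and g: "rng_finite g"
    and supp: "\<And>\<gamma>. f \<gamma> \<noteq> 0 \<Longrightarrow> rng \<gamma> = u \<and> src \<gamma> = u" "\<And>\<gamma>. g \<gamma> \<noteq> 0 \<Longrightarrow> rng \<gamma> = u \<and> src \<gamma> = u"
  shows "isotropy_sum u (convolution G f g) = isotropy_sum u f * isotropy_sum u g"
proof -
  define H where "H = {\<gamma> \<in> arrows G. rng \<gamma> = u \<and> src \<gamma> = u}"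
  define S where "S = {\<gamma>. f \<gamma> \<noteq> 0}"
  define T where "T = {\<gamma>. g \<gamma> \<noteq> 0}"
  define P where "P = (\<lambda>(\<alpha>, \<beta>). \<alpha> \<bullet>\<^sub>G \<beta>) ` (S \<times> T)"
  have SH: "S \<subseteq> H" using supp(1) rng_finiteD(1)[OF f] by (auto simp: S_def H_def)
  have TH: "T \<subseteq> H" using supp(2) rng_finiteD(1)[OF g] by (auto simp: T_def H_def)
  have S_eq: "S = {\<gamma>. f \<gamma> \<noteq> 0 \<and> rng \<gamma> = u \<and> src \<gamma> = u}" using supp(1) by (auto simp: S_def)
  have T_eq: "T = {\<gamma>. g \<gamma> \<noteq> 0 \<and> rng \<gamma> = u \<and> src \<gamma> = u}" using supp(2) by (auto simp: T_def)
  have fin: "finite S" "finite T" unfolding S_eq T_eq by (intro finite_isotropy_support f g)+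
  have comp: "(\<alpha>, \<beta>) \<in> composable G" if "\<alpha> \<in> H" "\<beta> \<in> H" for \<alpha> \<beta>
    using that by (simp add: H_def composable_iff)
  have H_mul: "\<alpha> \<bullet>\<^sub>G \<beta> \<in> H" if "\<alpha> \<in> H" "\<beta> \<in> H" for \<alpha> \<beta>
    using that comp[OF that] mul_closed[OF comp[OF that]] rng_mul[OF comp[OF that]] src_mul[OF comp[OF that]]
    by (simp add: H_def)
  have H_quot: "iv \<alpha> \<bullet>\<^sub>G \<gamma> \<in> H" "\<alpha> \<bullet>\<^sub>G (iv \<alpha> \<bullet>\<^sub>G \<gamma>) = \<gamma>" if "\<alpha> \<in> H" "\<gamma> \<in> H" for \<alpha> \<gamma>
    using that quotient_arrow[of \<alpha> \<gamma>] by (simp_all add: H_def)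
  have PH: "P \<subseteq> H" using SH TH H_mul by (auto simp: P_def)
  have conv: "convolution G f g \<gamma> = (\<Sum>\<alpha>\<in>S. f \<alpha> * g (iv \<alpha> \<bullet>\<^sub>G \<gamma>))" if "\<gamma> \<in> H" for \<gamma>
    using that SH fin by (intro convolution_eq_sum) (auto simp: S_def H_def)
  have supp_conv: "\<gamma> \<in> P" if "convolution G f g \<gamma> \<noteq> 0" "rng \<gamma> = u" "src \<gamma> = u" for \<gamma>
  proof -
    have "\<gamma> \<in> H" using that convolution_outside[of \<gamma> f g] by (auto simp: H_def)
    then have "(\<Sum>\<alpha>\<in>S. f \<alpha> * g (iv \<alpha> \<bullet>\<^sub>G \<gamma>)) \<noteq> 0" using that(1) conv by simp
    from sum.not_neutral_contains_not_neutral[OF this]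
    obtain \<alpha> where \<alpha>: "\<alpha> \<in> S" "f \<alpha> * g (iv \<alpha> \<bullet>\<^sub>G \<gamma>) \<noteq> 0" by blast
    then have "(\<alpha>, iv \<alpha> \<bullet>\<^sub>G \<gamma>) \<in> S \<times> T" by (simp add: T_def)
    then have "(\<lambda>(\<alpha>, \<beta>). \<alpha> \<bullet>\<^sub>G \<beta>) (\<alpha>, iv \<alpha> \<bullet>\<^sub>G \<gamma>) \<in> P" unfolding P_def by (rule imageI)
    then show ?thesis using H_quot(2)[of \<alpha> \<gamma>] \<alpha>(1) SH \<open>\<gamma> \<in> H\<close> by auto
  qed
  have "isotropy_sum u (convolution G f g) = (\<Sum>\<gamma>\<in>P. convolution G f g \<gamma>)"
  proof (rule isotropy_sum_eq)
    show "finite P" using fin by (simp add: P_def)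
    show "{\<gamma>. convolution G f g \<gamma> \<noteq> 0 \<and> rng \<gamma> = u \<and> src \<gamma> = u} \<subseteq> P" using supp_conv by blast
    show "rng \<gamma> = u \<and> src \<gamma> = u" if "\<gamma> \<in> P" for \<gamma> using that PH by (auto simp: H_def)
  qed
  also have "\<dots> = (\<Sum>\<gamma>\<in>P. \<Sum>\<alpha>\<in>S. f \<alpha> * g (iv \<alpha> \<bullet>\<^sub>G \<gamma>))"
    using PH conv by (intro sum.cong) auto
  also have "\<dots> = (\<Sum>\<alpha>\<in>S. f \<alpha> * (\<Sum>\<gamma>\<in>P. g (iv \<alpha> \<bullet>\<^sub>G \<gamma>)))"
    by (subst sum.swap) (simp add: sum_distrib_left)
  also have "\<dots> = (\<Sum>\<alpha>\<in>S. f \<alpha> * isotropy_sum u g)"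
  proof (rule sum.cong[OF refl])
    fix \<alpha> assume \<alpha>: "\<alpha> \<in> S"
    with SH have "\<alpha> \<in> H" by auto
    have inj: "inj_on (\<lambda>\<gamma>. iv \<alpha> \<bullet>\<^sub>G \<gamma>) P"
      using PH H_quot(2)[OF \<open>\<alpha> \<in> H\<close>] by (intro inj_on_inverseI[of _ "\<lambda>\<delta>. \<alpha> \<bullet>\<^sub>G \<delta>"]) auto
    have "isotropy_sum u g = sum g ((\<lambda>\<gamma>. iv \<alpha> \<bullet>\<^sub>G \<gamma>) ` P)"
    proof (rule isotropy_sum_eq)
      show "finite ((\<lambda>\<gamma>. iv \<alpha> \<bullet>\<^sub>G \<gamma>) ` P)" using fin by (simp add: P_def)
      show "{\<gamma>. g \<gamma> \<noteq> 0 \<and> rng \<gamma> = u \<and> src \<gamma> = u} \<subseteq> (\<lambda>\<gamma>. iv \<alpha> \<bullet>\<^sub>G \<gamma>) ` P"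
        unfolding T_eq[symmetric]
      proof
        fix \<beta> assume \<beta>: "\<beta> \<in> T"
        have "(\<lambda>(\<alpha>, \<beta>). \<alpha> \<bullet>\<^sub>G \<beta>) (\<alpha>, \<beta>) \<in> P" unfolding P_def using \<alpha> \<beta> by (intro imageI) simp
        moreover have "\<beta> = iv \<alpha> \<bullet>\<^sub>G (\<alpha> \<bullet>\<^sub>G \<beta>)"
          using mul_cancel_left[of \<alpha> \<beta>] comp[of \<alpha> \<beta>] \<open>\<alpha> \<in> H\<close> \<beta> TH by auto
        ultimately show "\<beta> \<in> (\<lambda>\<gamma>. iv \<alpha> \<bullet>\<^sub>G \<gamma>) ` P" by (intro image_eqI) simp_all
      qed
      show "rng \<gamma> = u \<and> src \<gamma> = u" if "\<gamma> \<in> (\<lambda>\<gamma>. iv \<alpha> \<bullet>\<^sub>G \<gamma>) ` P" for \<gamma>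
        using that PH H_quot(1)[OF \<open>\<alpha> \<in> H\<close>] by (auto simp: H_def)
    qed
    also have "\<dots> = (\<Sum>\<gamma>\<in>P. g (iv \<alpha> \<bullet>\<^sub>G \<gamma>))" by (simp add: sum.reindex[OF inj])
    finally show "f \<alpha> * (\<Sum>\<gamma>\<in>P. g (iv \<alpha> \<bullet>\<^sub>G \<gamma>)) = f \<alpha> * isotropy_sum u g" by simp
  qed
  also have "\<dots> = isotropy_sum u f * isotropy_sum u g"
    by (simp add: isotropy_sum_def[of u f] S_eq sum_distrib_right)
  finally show ?thesis .
qed

end

section \<open>Open bisections of etale groupoids\<close>

lemma local_homeomorphism_imp_open_map:
  assumes "local_homeomorphism X Y f"
  shows "open_map X Y f"
  unfolding open_map_def
proof (intro allI impI)
  fix V assume V: "openin X V"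
  show "openin Y (f ` V)"
  proof (subst openin_subopen, intro ballI)
    fix y assume "y \<in> f ` V"
    then obtain x where x: "x \<in> V" "y = f x" by auto
    then have "x \<in> topspace X" using V openin_subset by blast
    then obtain U where U: "openin X U" "x \<in> U" "homeo_onto_open X Y f U"
      using assms unfolding local_homeomorphism_def by blast
    then have hm: "homeomorphic_map (subtopology X U) (subtopology Y (f ` U)) f"
      and fU: "openin Y (f ` U)" by (auto simp: homeo_onto_open_def)
    have "openin (subtopology X U) (U \<inter> V)" using V by (rule openin_subtopology_Int2)
    then have "openin (subtopology Y (f ` U)) (f ` (U \<inter> V))"
      using homeomorphic_imp_open_map[OF hm] by (simp add: open_map_def)
    then have "openin Y (f ` (U \<inter> V))" using fU openin_open_subtopology by blast
    with U x show "\<exists>T. openin Y T \<and> y \<in> T \<and> T \<subseteq> f ` V" by blast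
  qed
qed

lemma homeo_onto_open_iff_inj_on:
  assumes cont: "continuous_map X Y f" and open_map: "open_map X Y f" and U: "openin X U"
  shows "homeo_onto_open X Y f U \<longleftrightarrow> inj_on f U"
proof
  have top: "topspace (subtopology X U) = U" using openin_subset[OF U] by auto
  have fU: "openin Y (f ` U)" using open_map U by (simp add: open_map_def)
  then have top': "topspace (subtopology Y (f ` U)) = f ` U" using openin_subset by fastforce
  show "inj_on f U" if "homeo_onto_open X Y f U"
    using that homeomorphic_imp_injective_map top unfolding homeo_onto_open_def by fastforce
  assume inj: "inj_on f U"
  have "homeomorphic_map (subtopology X U) (subtopology Y (f ` U)) f"
  proof (rule bijective_open_imp_homeomorphic_map)
    show "continuous_map (subtopology X U) (subtopology Y (f ` U)) f"
      using cont by (simp add: continuous_map_in_subtopology continuous_map_from_subtopology)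
    show "open_map (subtopology X U) (subtopology Y (f ` U)) f"
      unfolding open_map_def
    proof (intro allI impI)
      fix V assume "openin (subtopology X U) V"
      then have "openin X V" "V \<subseteq> U" using U by (auto simp: openin_open_subtopology)
      then show "openin (subtopology Y (f ` U)) (f ` V)"
        using open_map fU by (auto simp: openin_open_subtopology open_map_def)
    qed
  qed (simp_all only: top top' inj)
  with fU show "homeo_onto_open X Y f U" by (simp add: homeo_onto_open_def)
qed

context topological_groupoid
begin

lemma continuous_map_divide:
  "continuous_map (subtopology (prod_topology (gtop G) (gtop G)) {(x, y). rng x = rng y}) (gtop G)
     (\<lambda>(x, y). iv x \<bullet>\<^sub>G y)"
proof -
  let ?R = "subtopology (prod_topology (gtop G) (gtop G)) {(x, y). rng x = rng y}"
  have top: "x \<in> arrows G" "y \<in> arrows G" "rng x = rng y" if "(x, y) \<in> topspace ?R" for x y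
    using that by (auto simp: arrows_def)
  have fst: "continuous_map ?R (gtop G) fst" and snd: "continuous_map ?R (gtop G) snd"
    by (simp_all add: continuous_map_from_subtopology continuous_map_fst continuous_map_snd)
  have "continuous_map ?R (gtop G) (\<lambda>p. iv (fst p))"
    using continuous_map_compose[OF fst continuous_inv] by (simp add: comp_def)
  then have "continuous_map ?R (prod_topology (gtop G) (gtop G)) (\<lambda>p. (iv (fst p), snd p))"
    using snd by (intro continuous_map_pairedI)
  moreover have "(\<lambda>p. (iv (fst p), snd p)) \<in> topspace ?R \<rightarrow> composable G"
  proof
    fix p assume "p \<in> topspace ?R"
    then have "(fst p, snd p) \<in> topspace ?R" by simp
    from top[OF this] show "(iv (fst p), snd p) \<in> composable G"
      by (simp add: composable_iff inv_closed)
  qed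
  ultimately have "continuous_map ?R (subtopology (prod_topology (gtop G) (gtop G)) (composable G))
      (\<lambda>p. (iv (fst p), snd p))"
    by (rule continuous_map_into_subtopology)
  from continuous_map_compose[OF this continuous_mul] show ?thesis
    by (simp add: comp_def case_prod_unfold)
qed

lemma continuous_map_src: "continuous_map (gtop G) (gtop G) src"
proof -
  have "continuous_map (gtop G) (subtopology (prod_topology (gtop G) (gtop G)) {(x, y). rng x = rng y}) (\<lambda>x. (x, x))"
    by (intro continuous_map_into_subtopology continuous_map_pairedI) (auto simp: Pi_iff)
  from continuous_map_compose[OF this continuous_map_divide] show ?thesis
    by (simp add: comp_def inv_mul_eq_src)
qed

lemma continuous_map_rng: "continuous_map (gtop G) (gtop G) rng"
proof (rule continuous_map_eq)
  show "continuous_map (gtop G) (gtop G) (src \<circ> iv)"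
    by (rule continuous_map_compose[OF continuous_inv continuous_map_src])
qed (simp add: arrows_def)

lemma continuous_map_unit_topology:
  "continuous_map (gtop G) (unit_topology G) src" "continuous_map (gtop G) (unit_topology G) rng"
  unfolding unit_topology_def using continuous_map_src continuous_map_rng
  by (auto intro!: continuous_map_into_subtopology simp flip: arrows_def)

end

context etale_groupoid
begin

text \<open>
  If \<open>src\<close> is injective on the open set \<open>U\<close>, an arrow \<open>x \<in> U\<close> with \<open>src x \<in> U\<close> is equal to its source and
  thus a unit. Such arrows form a neighbourhood of each unit in \<open>U\<close>.
\<close>
lemma openin_units: "openin (gtop G) (units G)"
proof (subst openin_subopen, intro ballI)
  fix u assume u: "u \<in> units G"
  then have uA: "u \<in> topspace (gtop G)" using unitsD(1) by (simp add: arrows_def)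
  then obtain U where U: "openin (gtop G) U" "u \<in> U" "homeo_onto_open (gtop G) (unit_topology G) src U"
    using src_local_homeo unfolding local_homeomorphism_def by blast
  have UA: "U \<subseteq> arrows G" using openin_subset[OF U(1)] by (simp add: arrows_def)
  have "inj_on src (topspace (subtopology (gtop G) U))"
    using U(3) unfolding homeo_onto_open_def by (blast intro: homeomorphic_imp_injective_map)
  then have inj: "inj_on src U"
    using UA by (simp add: arrows_def inf.absorb2)
  define W where "W = {x \<in> U. src x \<in> U}"
  have "openin (gtop G) W"
    unfolding W_def by (rule openin_continuous_map_preimage_gen[OF continuous_map_src U(1) U(1)])
  moreover have "u \<in> W" using U(2) unitsD(2)[OF u] by (simp add: W_def)
  moreover have "W \<subseteq> units G"
  proof
    fix x assume x: "x \<in> W"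
    then have "x \<in> arrows G" using UA by (auto simp: W_def)
    moreover from this have "x = src x" using x inj_onD[OF inj, of x "src x"] by (simp add: W_def)
    ultimately show "x \<in> units G" using src_units by metis
  qed
  ultimately show "\<exists>T. openin (gtop G) T \<and> u \<in> T \<and> T \<subseteq> units G" by blast
qed

lemma openin_unit_topology_iff: "openin (unit_topology G) V \<longleftrightarrow> openin (gtop G) V \<and> V \<subseteq> units G"
  unfolding unit_topology_def by (rule openin_open_subtopology[OF openin_units])

lemma open_map_src: "open_map (gtop G) (unit_topology G) src"
  by (rule local_homeomorphism_imp_open_map[OF src_local_homeo])

lemma open_map_rng: "open_map (gtop G) (unit_topology G) rng"
  unfolding open_map_def
proof (intro allI impI)
  fix V assume V: "openin (gtop G) V"
  then have VA: "V \<subseteq> arrows G" using openin_subset by (auto simp: arrows_def)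
  have "iv ` V = {x \<in> topspace (gtop G). iv x \<in> V}"
    using VA by (force simp: inv_inv inv_closed image_iff simp flip: arrows_def)
  then have "openin (gtop G) (iv ` V)"
    using openin_continuous_map_preimage[OF continuous_inv V] by simp
  then have "openin (unit_topology G) (src ` iv ` V)"
    using open_map_src by (simp add: open_map_def)
  moreover have "src ` iv ` V = rng ` V" using VA by (force simp: image_image)
  ultimately show "openin (unit_topology G) (rng ` V)" by simp
qed

text \<open>Source and range maps are continuous and open, so injectivity makes them homeomorphisms.\<close>
lemma open_bisection_iff:
  "open_bisection G U \<longleftrightarrow> openin (gtop G) U \<and> inj_on src U \<and> inj_on rng U"
  unfolding open_bisection_def
  using homeo_onto_open_iff_inj_on[OF continuous_map_unit_topology(1) open_map_src, of U]
    homeo_onto_open_iff_inj_on[OF continuous_map_unit_topology(2) open_map_rng, of U] by blast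

lemma compact_open_bisection_iff:
  "U \<in> compact_open_bisections G \<longleftrightarrow>
     openin (gtop G) U \<and> compactin (gtop G) U \<and> inj_on src U \<and> inj_on rng U"
  by (auto simp: compact_open_bisections_def open_bisection_iff)

text \<open>
  Let \<open>\<gamma> = \<alpha>\<beta>\<close>. For \<open>x\<close> near \<open>\<alpha>\<close> and \<open>\<delta>\<close> near \<open>\<gamma>\<close> of the same range, \<open>x\<^sup>-\<^sup>1\<delta>\<close> lies in \<open>V\<close> by continuity. Since the
  range map is open, each \<open>\<delta>\<close> near \<open>\<gamma>\<close> has the range of some \<open>x \<in> U\<close> near \<open>\<alpha>\<close>, and then \<open>\<delta> = x(x\<^sup>-\<^sup>1\<delta>)\<close>.
\<close>
lemma openin_product_set:
  assumes U: "openin (gtop G) U" and V: "openin (gtop G) V"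
  shows "openin (gtop G) (product_set U V)"
proof (subst openin_subopen, intro ballI)
  fix \<gamma> assume "\<gamma> \<in> product_set U V"
  then obtain \<alpha> \<beta> where \<alpha>\<beta>: "\<alpha> \<in> U" "\<beta> \<in> V" "(\<alpha>, \<beta>) \<in> composable G" "\<alpha> \<bullet>\<^sub>G \<beta> = \<gamma>"
    by (auto simp: product_set_def)
  note q = quotient_unique[OF \<alpha>\<beta>(3,4)]
  let ?P = "prod_topology (gtop G) (gtop G)" and ?R = "{(x, y). rng x = rng y}"
  have \<alpha>A: "\<alpha> \<in> arrows G" using \<alpha>\<beta>(3) by (simp add: composable_iff)
  have "openin (subtopology ?P ?R) {p \<in> topspace (subtopology ?P ?R). (\<lambda>(x, y). iv x \<bullet>\<^sub>G y) p \<in> V}"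
    by (rule openin_continuous_map_preimage[OF continuous_map_divide V])
  then obtain T where T: "openin ?P T"
    "{p \<in> topspace (subtopology ?P ?R). (\<lambda>(x, y). iv x \<bullet>\<^sub>G y) p \<in> V} = T \<inter> ?R"
    unfolding openin_subtopology by blast
  have "iv \<alpha> \<bullet>\<^sub>G \<gamma> \<in> V" using \<alpha>\<beta>(2) unfolding q(1) .
  then have "(\<alpha>, \<gamma>) \<in> {p \<in> topspace (subtopology ?P ?R). (\<lambda>(x, y). iv x \<bullet>\<^sub>G y) p \<in> V}"
    using q(2,4) \<alpha>A by (simp add: arrows_def)
  then have "(\<alpha>, \<gamma>) \<in> T" unfolding T(2) by blast
  then obtain X Y where XY: "openin (gtop G) X" "openin (gtop G) Y" "\<alpha> \<in> X" "\<gamma> \<in> Y" "X \<times> Y \<subseteq> T"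
    using T(1)[unfolded openin_prod_topology_alt, rule_format, of \<alpha> \<gamma>] by auto
  have XU: "openin (gtop G) (X \<inter> U)" using XY(1) U by (rule openin_Int)
  define W where "W = {\<delta> \<in> Y. rng \<delta> \<in> rng ` (X \<inter> U)}"
  have "openin (gtop G) (rng ` (X \<inter> U))"
    using open_map_rng XU by (simp add: open_map_def openin_unit_topology_iff)
  then have "openin (gtop G) W"
    unfolding W_def by (rule openin_continuous_map_preimage_gen[OF continuous_map_rng XY(2)])
  moreover have "rng \<alpha> \<in> rng ` (X \<inter> U)" using XY(3) \<alpha>\<beta>(1) by (intro imageI IntI)
  then have "\<gamma> \<in> W" using XY(4) q(2) by (simp add: W_def)
  moreover have "W \<subseteq> product_set U V"
  proof
    fix \<delta> assume "\<delta> \<in> W"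
    then have "rng \<delta> \<in> rng ` (X \<inter> U)" and \<delta>: "\<delta> \<in> Y" by (simp_all add: W_def)
    from this(1) obtain x where "rng \<delta> = rng x" "x \<in> X \<inter> U" by (rule imageE)
    then have x: "x \<in> X" "x \<in> U" "rng x = rng \<delta>" by simp_all
    have A: "x \<in> arrows G" "\<delta> \<in> arrows G"
      using x(1) \<delta> openin_subset[OF XY(1)] openin_subset[OF XY(2)] by (auto simp: arrows_def)
    have "(x, \<delta>) \<in> T" using x(1) \<delta> XY(5) by auto
    then have "(x, \<delta>) \<in> T \<inter> ?R" using x(3) by simp
    then have "iv x \<bullet>\<^sub>G \<delta> \<in> V" unfolding T(2)[symmetric] by simp
    then have "(x, iv x \<bullet>\<^sub>G \<delta>) \<in> U \<times> V \<inter> composable G"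
      using x(2) quotient_arrow(5)[OF A x(3)] by simp
    then have "(\<lambda>(\<alpha>, \<beta>). \<alpha> \<bullet>\<^sub>G \<beta>) (x, iv x \<bullet>\<^sub>G \<delta>) \<in> product_set U V"
      unfolding product_set_def by (rule imageI)
    then show "\<delta> \<in> product_set U V" using quotient_arrow(4)[OF A x(3)] by simp
  qed
  ultimately show "\<exists>T. openin (gtop G) T \<and> \<gamma> \<in> T \<and> T \<subseteq> product_set U V" by blast
qed

end

text \<open>
  In a Hausdorff groupoid the composable pairs are closed among all pairs, so the composable pairs
  in \<open>U \<times> V\<close> form a compact set.
\<close>
lemma (in topological_groupoid) compactin_product_set:
  assumes "Hausdorff_space (gtop G)" "compactin (gtop G) U" "compactin (gtop G) V"
  shows "compactin (gtop G) (product_set U V)"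
proof -
  let ?P = "prod_topology (gtop G) (gtop G)"
  have "continuous_map ?P (gtop G) (\<lambda>p. src (fst p))" "continuous_map ?P (gtop G) (\<lambda>p. rng (snd p))"
    using continuous_map_compose[OF continuous_map_fst continuous_map_src, of "gtop G"]
      continuous_map_compose[OF continuous_map_snd continuous_map_rng, of "gtop G"]
    by (simp_all only: comp_def)
  from closedin_continuous_maps_eq[OF assms(1) this]
  have "closedin ?P {p \<in> topspace ?P. src (fst p) = rng (snd p)}" .
  moreover have "{p \<in> topspace ?P. src (fst p) = rng (snd p)} = composable G"
    by (simp add: composable_def arrows_def set_eq_iff)
  ultimately have "closedin ?P (composable G)" by simp
  moreover have "compactin ?P (U \<times> V)" using assms(2,3) by (simp add: compactin_Times)
  ultimately have "compactin ?P (U \<times> V \<inter> composable G)" by (rule compact_Int_closedin[rotated])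
  then have "compactin (subtopology ?P (composable G)) (U \<times> V \<inter> composable G)"
    by (simp add: compactin_subtopology)
  then show ?thesis
    unfolding product_set_def by (rule image_compactin[OF _ continuous_mul])
qed

context groupoid
begin

lemma product_setE:
  assumes "\<gamma> \<in> product_set U V"
  obtains \<alpha> \<beta> where "\<alpha> \<in> U" "\<beta> \<in> V" "src \<alpha> = rng \<beta>" "\<gamma> = \<alpha> \<bullet>\<^sub>G \<beta>"
    "src \<gamma> = src \<beta>" "rng \<gamma> = rng \<alpha>"
proof -
  from assms obtain \<alpha> \<beta>
    where p: "\<alpha> \<in> U" "\<beta> \<in> V" "(\<alpha>, \<beta>) \<in> composable G" "\<gamma> = \<alpha> \<bullet>\<^sub>G \<beta>"
    unfolding product_set_def by auto
  have "src \<alpha> = rng \<beta>" using p(3) by (simp add: composable_iff)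
  then show thesis
    using that[OF p(1,2) _ p(4)] src_mul[OF p(3)] rng_mul[OF p(3)] unfolding p(4) by simp
qed

lemma inj_on_product_set:
  assumes "inj_on src U" "inj_on src V" "inj_on rng U" "inj_on rng V"
  shows "inj_on src (product_set U V)" "inj_on rng (product_set U V)"
proof -
  show "inj_on src (product_set U V)"
  proof (rule inj_onI)
    fix x y assume x: "x \<in> product_set U V" and y: "y \<in> product_set U V" and eq: "src x = src y"
    obtain \<alpha> \<beta>
      where 1: "\<alpha> \<in> U" "\<beta> \<in> V" "src \<alpha> = rng \<beta>" "x = \<alpha> \<bullet>\<^sub>G \<beta>" "src x = src \<beta>" "rng x = rng \<alpha>"
      by (rule product_setE[OF x])
    obtain \<alpha>' \<beta>'
      where 2: "\<alpha>' \<in> U" "\<beta>' \<in> V" "src \<alpha>' = rng \<beta>'" "y = \<alpha>' \<bullet>\<^sub>G \<beta>'" "src y = src \<beta>'" "rng y = rng \<alpha>'"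
      by (rule product_setE[OF y])
    have "\<beta> = \<beta>'" using inj_onD[OF assms(2) _ 1(2) 2(2)] 1(5) 2(5) eq by simp
    moreover from this have "\<alpha> = \<alpha>'" using inj_onD[OF assms(1) _ 1(1) 2(1)] 1(3) 2(3) by simp
    ultimately show "x = y" unfolding 1(4) 2(4) by simp
  qed
  show "inj_on rng (product_set U V)"
  proof (rule inj_onI)
    fix x y assume x: "x \<in> product_set U V" and y: "y \<in> product_set U V" and eq: "rng x = rng y"
    obtain \<alpha> \<beta>
      where 1: "\<alpha> \<in> U" "\<beta> \<in> V" "src \<alpha> = rng \<beta>" "x = \<alpha> \<bullet>\<^sub>G \<beta>" "src x = src \<beta>" "rng x = rng \<alpha>"
      by (rule product_setE[OF x])
    obtain \<alpha>' \<beta>'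
      where 2: "\<alpha>' \<in> U" "\<beta>' \<in> V" "src \<alpha>' = rng \<beta>'" "y = \<alpha>' \<bullet>\<^sub>G \<beta>'" "src y = src \<beta>'" "rng y = rng \<alpha>'"
      by (rule product_setE[OF y])
    have "\<alpha> = \<alpha>'" using inj_onD[OF assms(3) _ 1(1) 2(1)] 1(6) 2(6) eq by simp
    moreover from this have "\<beta> = \<beta>'" using inj_onD[OF assms(4) _ 1(2) 2(2)] 1(3) 2(3) by simp
    ultimately show "x = y" unfolding 1(4) 2(4) by simp
  qed
qed

end

section \<open>Steinberg algebras\<close>

context Hausdorff_ample_groupoid
begin

lemma compact_open_bisection_subset_arrows:
  "U \<in> compact_open_bisections G \<Longrightarrow> U \<subseteq> arrows G"
  using openin_subset by (auto simp: compact_open_bisection_iff arrows_def)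

lemma compact_open_bisection_basis:
  assumes "openin (gtop G) W" "x \<in> W"
  obtains U where "U \<in> compact_open_bisections G" "x \<in> U" "U \<subseteq> W"
proof -
  from base[OF assms(1)] obtain \<U> where "\<U> \<subseteq> compact_open_bisections G" "\<Union>\<U> = W" by blast
  with assms(2) that show thesis by blast
qed

lemma product_set_compact_open_bisection:
  assumes "U \<in> compact_open_bisections G" "V \<in> compact_open_bisections G"
  shows "product_set U V \<in> compact_open_bisections G"
  using assms openin_product_set[of U V] compactin_product_set[OF Hausdorff, of U V] inj_on_product_set[of U V]
  unfolding compact_open_bisection_iff by simp

lemma subspace_steinberg_algebra: "fscale.subspace (steinberg_algebra G)"
  unfolding steinberg_algebra_def by (rule fscale.subspace_span)

lemma indicator_in_steinberg_algebra:
  "U \<in> compact_open_bisections G \<Longrightarrow> indicator U \<in> steinberg_algebra G"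
  unfolding steinberg_algebra_def by (intro fscale.span_base imageI)

lemma steinberg_algebra_induct [consumes 1, case_names subspace indicator]:
  assumes f: "f \<in> steinberg_algebra G" and P: "fscale.subspace {f. P f}"
    and ind: "\<And>U. U \<in> compact_open_bisections G \<Longrightarrow> P (indicator U)"
  shows "P f"
proof -
  have "steinberg_algebra G \<subseteq> {f. P f}"
    unfolding steinberg_algebra_def using ind by (intro fscale.span_minimal[OF _ P]) auto
  with f show ?thesis by auto
qed

lemma rng_finite_steinberg_algebra:
  assumes "f \<in> steinberg_algebra G"
  shows "rng_finite f"
  using assms
proof (induction rule: steinberg_algebra_induct)
  case subspace
  show ?case
    by (simp add: fscale.subspace_def rng_finite_zero rng_finite_add rng_finite_fscale)
next
  case (indicator U)
  then show ?case
    using compact_open_bisection_subset_arrows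
    by (intro rng_finite_indicator) (simp_all add: compact_open_bisection_iff)
qed

lemma convolution_in_steinberg_algebra:
  fixes f g :: "'a \<Rightarrow> 'k::field"
  assumes f: "f \<in> steinberg_algebra G" and g: "g \<in> steinberg_algebra G"
  shows "convolution G f g \<in> steinberg_algebra G"
proof -
  have zero: "convolution G f 0 = 0" "convolution G 0 f = 0" for f :: "'a \<Rightarrow> 'k"
    by (simp_all add: convolution_def fun_eq_iff)
  note A = fscale.subspace_0[OF subspace_steinberg_algebra] fscale.subspace_add[OF subspace_steinberg_algebra]
    fscale.subspace_scale[OF subspace_steinberg_algebra]
  have "rng_finite f \<and> convolution G f g \<in> steinberg_algebra G"
    using f
  proof (induction rule: steinberg_algebra_induct)
    case subspace
    show ?case
      by (simp add: A fscale.subspace_def zero rng_finite_zero rng_finite_add rng_finite_fscale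
          convolution_add_left convolution_fscale_left)
  next
    case (indicator U)
    then have U: "rng_finite (indicator U :: 'a \<Rightarrow> 'k)"
      by (intro rng_finite_steinberg_algebra indicator_in_steinberg_algebra)
    have "convolution G (indicator U) g \<in> steinberg_algebra G"
      using g
    proof (induction rule: steinberg_algebra_induct)
      case subspace
      show ?case
        by (simp add: A fscale.subspace_def zero convolution_add_right[OF U] convolution_fscale_right[OF U])
    next
      case (indicator V)
      have "convolution G (indicator U) (indicator V) = (indicator (product_set U V) :: 'a \<Rightarrow> 'k)"
        using \<open>U \<in> compact_open_bisections G\<close> indicator compact_open_bisection_subset_arrows
        by (intro convolution_indicators) (simp_all add: compact_open_bisection_iff)
      then show ?case
        using product_set_compact_open_bisection[OF \<open>U \<in> compact_open_bisections G\<close> indicator]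
        by (simp add: indicator_in_steinberg_algebra)
    qed
    with U show ?case by simp
  qed
  then show ?thesis by simp
qed

definition compact_open_units :: "'a set \<Rightarrow> bool" where
  "compact_open_units W \<longleftrightarrow> openin (gtop G) W \<and> compactin (gtop G) W \<and> W \<subseteq> units G"

lemma compact_open_units_bisection:
  assumes "compact_open_units W"
  shows "W \<in> compact_open_bisections G"
proof -
  have "src w = w" "rng w = w" if "w \<in> W" for w
    using that assms unitsD by (auto simp: compact_open_units_def)
  then have "inj_on src W" "inj_on rng W" by (simp_all add: inj_on_def)
  with assms show ?thesis by (simp add: compact_open_units_def compact_open_bisection_iff)
qed

lemma indicator_units_in_steinberg_algebra:
  "compact_open_units W \<Longrightarrow> indicator W \<in> steinberg_algebra G"
  by (intro indicator_in_steinberg_algebra compact_open_units_bisection)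

lemma compact_open_units_Un:
  "compact_open_units V \<Longrightarrow> compact_open_units W \<Longrightarrow> compact_open_units (V \<union> W)"
  by (auto simp: compact_open_units_def compactin_Un)

lemma compact_open_units_empty: "compact_open_units {}"
  by (simp add: compact_open_units_def)

lemma compact_open_units_image:
  assumes "U \<in> compact_open_bisections G"
  shows "compact_open_units (src ` U)" "compact_open_units (rng ` U)"
  using assms open_map_src open_map_rng continuous_map_src continuous_map_rng
  by (auto simp: compact_open_bisection_iff compact_open_units_def open_map_def openin_unit_topology_iff
      intro: image_compactin)

lemma unit_neighbourhood:
  assumes "u \<in> units G" "openin (gtop G) O'" "u \<in> O'"
  obtains W where "compact_open_units W" "u \<in> W" "W \<subseteq> O'"
proof -
  have "openin (gtop G) (O' \<inter> units G)" using assms(2) openin_units by (rule openin_Int)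
  then obtain W where "W \<in> compact_open_bisections G" "u \<in> W" "W \<subseteq> O' \<inter> units G"
    using assms by (elim compact_open_bisection_basis[of _ u]) auto
  with that show thesis by (auto simp: compact_open_units_def compact_open_bisection_iff)
qed

lemma separate_units:
  assumes "u \<in> units G" "v \<in> units G" "u \<noteq> v"
  obtains V W where "openin (gtop G) V" "openin (gtop G) W" "u \<in> V" "v \<in> W" "V \<inter> W = {}"
proof -
  have "u \<in> topspace (gtop G)" "v \<in> topspace (gtop G)" using assms unitsD(1) by (auto simp: arrows_def)
  then show thesis
    using Hausdorff \<open>u \<noteq> v\<close> that unfolding Hausdorff_space_def disjnt_def by blast
qed

lemma support_in_compact_open_units:
  fixes f :: "'a \<Rightarrow> 'k::field"
  assumes "f \<in> steinberg_algebra G"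
  shows "\<exists>W. compact_open_units W \<and> (\<forall>\<gamma>. f \<gamma> \<noteq> 0 \<longrightarrow> rng \<gamma> \<in> W \<and> src \<gamma> \<in> W)"
  using assms
proof (induction rule: steinberg_algebra_induct)
  case subspace
  show ?case
    unfolding fscale.subspace_def
  proof (intro conjI ballI allI)
    show "0 \<in> {f. \<exists>W. compact_open_units W \<and> (\<forall>\<gamma>. f \<gamma> \<noteq> 0 \<longrightarrow> rng \<gamma> \<in> W \<and> src \<gamma> \<in> W)}"
      using compact_open_units_empty by auto
  next
    fix f g :: "'a \<Rightarrow> 'k"
    assume "f \<in> {f. \<exists>W. compact_open_units W \<and> (\<forall>\<gamma>. f \<gamma> \<noteq> 0 \<longrightarrow> rng \<gamma> \<in> W \<and> src \<gamma> \<in> W)}"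
      "g \<in> {f. \<exists>W. compact_open_units W \<and> (\<forall>\<gamma>. f \<gamma> \<noteq> 0 \<longrightarrow> rng \<gamma> \<in> W \<and> src \<gamma> \<in> W)}"
    then obtain V W where V: "compact_open_units V" "\<And>\<gamma>. f \<gamma> \<noteq> 0 \<Longrightarrow> rng \<gamma> \<in> V \<and> src \<gamma> \<in> V"
      and W: "compact_open_units W" "\<And>\<gamma>. g \<gamma> \<noteq> 0 \<Longrightarrow> rng \<gamma> \<in> W \<and> src \<gamma> \<in> W" by blast
    have "rng \<gamma> \<in> V \<union> W \<and> src \<gamma> \<in> V \<union> W" if "(f + g) \<gamma> \<noteq> 0" for \<gamma>
    proof -
      from that have "f \<gamma> \<noteq> 0 \<or> g \<gamma> \<noteq> 0" by auto
      then show ?thesis using V(2) W(2) by blast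
    qed
    then show "f + g \<in> {f. \<exists>W. compact_open_units W \<and> (\<forall>\<gamma>. f \<gamma> \<noteq> 0 \<longrightarrow> rng \<gamma> \<in> W \<and> src \<gamma> \<in> W)}"
      using compact_open_units_Un[OF V(1) W(1)] by (intro CollectI exI[of _ "V \<union> W"]) blast
  next
    fix c and f :: "'a \<Rightarrow> 'k"
    assume "f \<in> {f. \<exists>W. compact_open_units W \<and> (\<forall>\<gamma>. f \<gamma> \<noteq> 0 \<longrightarrow> rng \<gamma> \<in> W \<and> src \<gamma> \<in> W)}"
    then show "fscale c f \<in> {f. \<exists>W. compact_open_units W \<and> (\<forall>\<gamma>. f \<gamma> \<noteq> 0 \<longrightarrow> rng \<gamma> \<in> W \<and> src \<gamma> \<in> W)}"
      by (auto simp: fscale_def)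
  qed
next
  case (indicator U)
  show ?case
    using compact_open_units_Un[OF compact_open_units_image[OF indicator]]
    by (intro exI[of _ "src ` U \<union> rng ` U"]) (auto simp: indicator_def)
qed

lemma finite_support_in_compact_open_units:
  assumes "finite F" "F \<subseteq> steinberg_algebra G"
  shows "\<exists>W. compact_open_units W \<and> (\<forall>f\<in>F. \<forall>\<gamma>. f \<gamma> \<noteq> 0 \<longrightarrow> rng \<gamma> \<in> W \<and> src \<gamma> \<in> W)"
  using assms
proof (induction F rule: finite_induct)
  case empty
  then show ?case using compact_open_units_empty by auto
next
  case (insert f F)
  then have "\<exists>V. compact_open_units V \<and> (\<forall>f\<in>F. \<forall>\<gamma>. f \<gamma> \<noteq> 0 \<longrightarrow> rng \<gamma> \<in> V \<and> src \<gamma> \<in> V)" by simp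
  then obtain V where V: "compact_open_units V" "\<And>f \<gamma>. f \<in> F \<Longrightarrow> f \<gamma> \<noteq> 0 \<Longrightarrow> rng \<gamma> \<in> V \<and> src \<gamma> \<in> V"
    by blast
  obtain W where W: "compact_open_units W" "\<And>\<gamma>. f \<gamma> \<noteq> 0 \<Longrightarrow> rng \<gamma> \<in> W \<and> src \<gamma> \<in> W"
    using support_in_compact_open_units[of f] insert.prems by blast
  have "rng \<gamma> \<in> V \<union> W \<and> src \<gamma> \<in> V \<union> W" if "h \<in> insert f F" "h \<gamma> \<noteq> 0" for h \<gamma>
    using that V(2)[of h \<gamma>] W(2)[of \<gamma>] by auto
  then show ?case
    using compact_open_units_Un[OF V(1) W(1)] by (intro exI[of _ "V \<union> W"]) blast
qed

lemma convolution_local_unit: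
  assumes "W \<subseteq> units G" "rng_finite f" "\<And>\<gamma>. f \<gamma> \<noteq> 0 \<Longrightarrow> rng \<gamma> \<in> W \<and> src \<gamma> \<in> W"
  shows "convolution G (indicator W) f = f" "convolution G f (indicator W) = f"
  using assms(3)
  by (auto simp: fun_eq_iff convolution_units_left[OF assms(1,2)] convolution_units_right[OF assms(1,2)] indicator_def)

lemma steinberg_algebra_local_units:
  fixes F :: "('a \<Rightarrow> 'k::field) set"
  assumes "finite F" "F \<subseteq> steinberg_algebra G"
  obtains W where "compact_open_units W" "\<And>f. f \<in> F \<Longrightarrow> convolution G (indicator W) f = f"
    "\<And>f. f \<in> F \<Longrightarrow> convolution G f (indicator W) = f"
proof -
  obtain W where W: "compact_open_units W" "\<And>f \<gamma>. f \<in> F \<Longrightarrow> f \<gamma> \<noteq> 0 \<Longrightarrow> rng \<gamma> \<in> W \<and> src \<gamma> \<in> W"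
    using finite_support_in_compact_open_units[OF assms] by blast
  have "convolution G (indicator W) f = f \<and> convolution G f (indicator W) = f" if "f \<in> F" for f
    using convolution_local_unit[of W f] W rng_finite_steinberg_algebra assms(2) that
    by (auto simp: compact_open_units_def)
  with that W(1) show thesis by blast
qed

lemma convolution_unit_indicators:
  assumes "compact_open_units V" "compact_open_units W"
  shows "convolution G (indicator V) (indicator W) = (indicator (V \<inter> W) :: 'a \<Rightarrow> 'k::field)"
proof
  fix \<gamma>
  have VW: "V \<subseteq> units G" "W \<subseteq> units G" using assms by (auto simp: compact_open_units_def)
  have "rng_finite (indicator W :: 'a \<Rightarrow> 'k)"
    using assms by (intro rng_finite_steinberg_algebra indicator_units_in_steinberg_algebra)
  from convolution_units_left[OF VW(1) this, of \<gamma>]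
  show "convolution G (indicator V) (indicator W) \<gamma> = (indicator (V \<inter> W) \<gamma> :: 'k)"
    using unitsD(3)[of \<gamma>] VW by (auto simp: indicator_def)
qed

text \<open>
  Multiplying by the characteristic functions of compact open sets of units shows that \<open>f\<close> is
  \<open>1\<close> on units and \<open>0\<close> elsewhere. The support of an element of the Steinberg algebra has its
  ranges and sources in a compact set of units, which must then contain all units.
\<close>
lemma steinberg_algebra_left_identity:
  fixes f :: "'a \<Rightarrow> 'k::field"
  assumes f: "f \<in> steinberg_algebra G" and id: "\<And>a. a \<in> steinberg_algebra G \<Longrightarrow> convolution G f a = a"
  shows "f = indicator (units G)" "compactin (gtop G) (units G)"
proof -
  note fin = rng_finite_steinberg_algebra[OF f]
  have eq: "f \<gamma> = indicator W \<gamma>"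
    if "compact_open_units W" "src \<gamma> \<in> W" for \<gamma> W
  proof -
    have "f \<gamma> = f \<gamma> * indicator W (src \<gamma>)" using that by simp
    also have "\<dots> = convolution G f (indicator W) \<gamma>"
      using that fin by (simp add: convolution_units_right compact_open_units_def)
    also have "\<dots> = indicator W \<gamma>" using id[OF indicator_units_in_steinberg_algebra[OF that(1)]] by simp
    finally show ?thesis .
  qed
  show 1: "f = indicator (units G)"
  proof
    fix \<gamma>
    show "f \<gamma> = indicator (units G) \<gamma>"
    proof (cases "\<gamma> \<in> arrows G")
      case True
      then have "src \<gamma> \<in> units G" by simp
      from unit_neighbourhood[OF this openin_units this]
      obtain W where W: "compact_open_units W" "src \<gamma> \<in> W" .
      have "\<gamma> \<in> W \<longleftrightarrow> \<gamma> \<in> units G"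
        using W unitsD(2)[of \<gamma>] by (auto simp: compact_open_units_def)
      then show ?thesis using eq[OF W] by (simp add: indicator_def)
    next
      case False
      then have "\<gamma> \<notin> units G" using unitsD(1) by auto
      then show ?thesis using rng_finiteD(2)[OF fin False] by simp
    qed
  qed
  obtain W where W: "compact_open_units W" "\<And>\<gamma>. f \<gamma> \<noteq> 0 \<Longrightarrow> rng \<gamma> \<in> W \<and> src \<gamma> \<in> W"
    using support_in_compact_open_units[OF f] by blast
  have "units G \<subseteq> W"
  proof
    fix u assume u: "u \<in> units G"
    then have "f u \<noteq> 0" unfolding 1 by simp
    then show "u \<in> W" using W(2)[of u] unitsD(2)[OF u] by simp
  qed
  with W(1) have "W = units G" by (auto simp: compact_open_units_def)
  with W(1) show "compactin (gtop G) (units G)" by (simp add: compact_open_units_def)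
qed

end

section \<open>Simple Steinberg algebras\<close>

text \<open>
  Here \<open>mu\<close> stands for a product that agrees with convolution on the Steinberg algebra and obeys the
  laws of an algebra for all functions, whereas convolution itself does so only where its sums are
  finite.
\<close>
locale simple_steinberg_algebra = Hausdorff_ample_groupoid G
  for G :: "'g top_groupoid" +
  fixes mu :: "('g \<Rightarrow> 'k::field) \<Rightarrow> ('g \<Rightarrow> 'k) \<Rightarrow> 'g \<Rightarrow> 'k"
  assumes simple_subalgebra: "simple_subalgebra fscale mu (steinberg_algebra G)"
    and mu_eq: "x \<in> steinberg_algebra G \<Longrightarrow> y \<in> steinberg_algebra G \<Longrightarrow> mu x y = convolution G x y"
    and mu_in: "mu x y \<in> steinberg_algebra G"
begin

sublocale S: simple_subalgebra fscale mu "steinberg_algebra G"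
  by (rule simple_subalgebra)

lemma bracket_eq:
  assumes "x \<in> steinberg_algebra G" "y \<in> steinberg_algebra G"
  shows "S.bracket x y = steinberg_bracket G x y"
  using assms by (simp add: commutator_def mu_eq)

lemma steinberg_commutators_eq: "(steinberg_commutators G :: ('g \<Rightarrow> 'k) set) = S.commutators"
  unfolding steinberg_commutators_def S.commutators_def
  by (rule product_span_cong) (rule bracket_eq[symmetric])

lemma simple_lie_algebra_iff:
  "simple_lie_algebra fscale (steinberg_bracket G) (steinberg_commutators G :: ('g \<Rightarrow> 'k) set) \<longleftrightarrow>
     simple_lie_algebra fscale S.bracket S.commutators"
  unfolding steinberg_commutators_eq
  by (rule simple_lie_algebra_cong) (simp add: bracket_eq)

lemma identityD:
  assumes "S.identity f"
  shows "f = indicator (units G)" "compactin (gtop G) (units G)"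
  using steinberg_algebra_left_identity[of f] assms mu_eq by (auto simp: S.identity_def)

lemma identity_indicator_units:
  assumes "compactin (gtop G) (units G)"
  shows "S.identity (indicator (units G))"
proof -
  have W: "compact_open_units (units G)"
    using assms openin_units by (simp add: compact_open_units_def)
  have e: "(indicator (units G) :: 'g \<Rightarrow> 'k) \<in> steinberg_algebra G"
    by (rule indicator_units_in_steinberg_algebra[OF W])
  have "convolution G (indicator (units G)) a = a \<and> convolution G a (indicator (units G)) = a"
    if a: "a \<in> steinberg_algebra G" for a :: "'g \<Rightarrow> 'k"
    using convolution_local_unit[of "units G" a] rng_finite_steinberg_algebra[OF a]
      rng_finiteD(1)[OF rng_finite_steinberg_algebra[OF a]] by auto
  with e show ?thesis by (simp add: S.identity_def mu_eq)
qed

lemma units_nonempty: "units G \<noteq> {}"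
proof
  assume "units G = {}"
  then have "arrows G = {}" by (simp add: units_def)
  then have "f = 0" if "f \<in> steinberg_algebra G" for f :: "'g \<Rightarrow> 'k"
    using rng_finiteD(2)[OF rng_finite_steinberg_algebra[OF that]] by auto
  then have "product_span fscale mu (steinberg_algebra G) \<subseteq> {0}"
    unfolding product_span_def by (intro fscale.span_minimal) (auto simp: fscale.subspace_single_0)
  moreover have "0 \<in> product_span fscale mu (steinberg_algebra G)"
    unfolding product_span_def by (rule fscale.span_zero)
  ultimately have "product_span fscale mu (steinberg_algebra G) = {0}" by auto
  with S.simple show False by (simp add: simple_algebra_def)
qed

lemma mu_indicators:
  assumes "compact_open_units V" "compact_open_units W"
  shows "mu (indicator V) (indicator W) = indicator (V \<inter> W)"
  using assms by (simp add: mu_eq indicator_units_in_steinberg_algebra convolution_unit_indicators)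

lemma corner_support:
  assumes "compact_open_units W" "f \<in> steinberg_algebra G"
  shows "mu (mu (indicator W) f) (indicator W) \<gamma> = indicator W (rng \<gamma>) * f \<gamma> * indicator W (src \<gamma>)"
proof -
  have W: "W \<subseteq> units G" using assms(1) by (simp add: compact_open_units_def)
  note e = indicator_units_in_steinberg_algebra[OF assms(1)]
  have "mu (mu (indicator W) f) (indicator W) \<gamma> = mu (indicator W) f \<gamma> * indicator W (src \<gamma>)"
    using mu_eq[OF mu_in e] convolution_units_right[OF W rng_finite_steinberg_algebra[OF mu_in]] by simp
  then show ?thesis
    using mu_eq[OF e assms(2)] convolution_units_left[OF W rng_finite_steinberg_algebra[OF assms(2)]] by simp
qed

text \<open>
  Let \<open>e\<close> be the characteristic function of \<open>{u}\<close>. An element \<open>j\<close> of \<open>eAe\<close> with augmentation zero is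
  zero: otherwise \<open>e\<close> would be a sum of products \<open>exjye = (exe)j(eye)\<close>, which have augmentation zero,
  whereas \<open>e\<close> has augmentation one. This applies to the difference of \<open>eae\<close> and its augmentation
  times \<open>e\<close>.
\<close>
lemma scalar_corner:
  assumes u: "u \<in> units G" and W: "compact_open_units {u}" and a: "a \<in> steinberg_algebra G"
  shows "\<exists>c. mu (mu (indicator {u}) a) (indicator {u}) = fscale c (indicator {u})"
proof -
  define e :: "'g \<Rightarrow> 'k" where "e = indicator {u}"
  define corner where "corner x = mu (mu e x) e" for x
  have e: "e \<in> steinberg_algebra G" "mu e e = e"
    using W mu_indicators[OF W W] by (simp_all add: e_def indicator_units_in_steinberg_algebra)
  have corner_in: "corner x \<in> steinberg_algebra G" "rng_finite (corner x)" for x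
    by (simp_all add: corner_def mu_in rng_finite_steinberg_algebra)
  have corner_eq: "corner x \<gamma> = indicator {u} (rng \<gamma>) * x \<gamma> * indicator {u} (src \<gamma>)"
    if "x \<in> steinberg_algebra G" for x \<gamma>
    unfolding corner_def e_def using W that by (rule corner_support)
  have corner_supp: "rng \<gamma> = u \<and> src \<gamma> = u" if "x \<in> steinberg_algebra G" "corner x \<gamma> \<noteq> 0" for x \<gamma>
    using that by (auto simp: corner_eq indicator_def split: if_splits)
  have corner_idem: "corner (corner x) = corner x" "mu e (corner x) = corner x" "mu (corner x) e = corner x" for x
    using e(2) by (simp_all add: corner_def S.mult_assoc) (simp_all add: e(2) flip: S.mult_assoc)
  define \<epsilon> where "\<epsilon> = (isotropy_sum u :: ('g \<Rightarrow> 'k) \<Rightarrow> 'k)"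
  have \<epsilon>_mult: "\<epsilon> (mu (corner x) (corner y)) = \<epsilon> (corner x) * \<epsilon> (corner y)"
    if xy: "x \<in> steinberg_algebra G" "y \<in> steinberg_algebra G" for x y
    unfolding \<epsilon>_def mu_eq[OF corner_in(1) corner_in(1)]
    by (rule isotropy_sum_convolution[OF u corner_in(2) corner_in(2) corner_supp[OF xy(1)] corner_supp[OF xy(2)]])
  have \<epsilon>_e: "\<epsilon> e = 1"
  proof -
    have "\<epsilon> e = sum e {u}"
      unfolding \<epsilon>_def using unitsD[OF u] by (intro isotropy_sum_eq) (auto simp: e_def indicator_def)
    then show ?thesis by (simp add: e_def)
  qed
  have \<epsilon>_add: "\<epsilon> (x + y) = \<epsilon> x + \<epsilon> y" if "x \<in> steinberg_algebra G" "y \<in> steinberg_algebra G" for x y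
    unfolding \<epsilon>_def using that by (intro isotropy_sum_add rng_finite_steinberg_algebra)
  have \<epsilon>_scale: "\<epsilon> (fscale c x) = c * \<epsilon> x" if "x \<in> steinberg_algebra G" for x c
    unfolding \<epsilon>_def using that by (intro isotropy_sum_fscale rng_finite_steinberg_algebra)
  define j where "j = corner a - fscale (\<epsilon> (corner a)) e"
  have j_in: "j \<in> steinberg_algebra G" unfolding j_def using corner_in e by blast
  have "corner e = e" using e(2) by (simp add: corner_def)
  then have corner_j: "corner j = j"
    unfolding j_def using corner_idem(1)[of a] by (simp add: corner_def S.mult_simps)
  have \<epsilon>_j: "\<epsilon> j = 0"
  proof -
    have "\<epsilon> (j + fscale (\<epsilon> (corner a)) e) = \<epsilon> j + \<epsilon> (corner a) * \<epsilon> e"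
      using j_in e(1) by (simp add: \<epsilon>_add \<epsilon>_scale S.A_closed)
    then show ?thesis by (simp add: j_def \<epsilon>_e)
  qed
  have "j = 0"
  proof (rule ccontr)
    assume "j \<noteq> 0"
    from j_in this e(1) have "\<epsilon> (corner e) = 0"
    proof (induction rule: S.sandwich_induct)
      case subspace
      have add: "corner (x + y) = corner x + corner y" and scale: "corner (fscale c x) = fscale c (corner x)"
        and zero: "corner 0 = 0" for x y c
        by (simp_all add: corner_def S.mult_simps)
      have "\<epsilon> 0 = 0" using \<epsilon>_scale[OF e(1), of 0] by simp
      then show ?case
        by (simp add: fscale.subspace_def add scale zero \<epsilon>_add \<epsilon>_scale corner_in(1))
    next
      case (sandwich x y)
      have "corner (mu (mu x j) y) = corner (mu (mu x (corner j)) y)" by (simp only: corner_j)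
      also have "\<dots> = mu (mu (corner x) (corner j)) (corner y)"
        using e(2) by (simp add: corner_def S.mult_assoc) (simp add: e(2) flip: S.mult_assoc)
      also have "mu (corner x) (corner j) = corner (mu (corner x) (corner j))"
        by (simp add: corner_def S.mult_assoc) (simp add: e(2) flip: S.mult_assoc)
      finally have "\<epsilon> (corner (mu (mu x j) y)) = \<epsilon> (corner (mu (corner x) (corner j))) * \<epsilon> (corner y)"
        using \<epsilon>_mult[OF mu_in sandwich(2)] by simp
      moreover have "corner (mu (corner x) (corner j)) = mu (corner x) (corner j)"
        by (simp add: corner_def S.mult_assoc) (simp add: e(2) flip: S.mult_assoc)
      ultimately show ?case using \<epsilon>_mult[OF sandwich(1) j_in] by (simp add: corner_j \<epsilon>_j)
    qed
    with \<epsilon>_e \<open>corner e = e\<close> show False by simp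
  qed
  then have "corner a = fscale (\<epsilon> (corner a)) e" by (simp add: j_def)
  then show ?thesis unfolding corner_def e_def by blast
qed

lemma indicator_units_nonzero:
  assumes "u \<in> W"
  shows "indicator W \<noteq> (0 :: 'g \<Rightarrow> 'k)"
proof
  assume "indicator W = (0 :: 'g \<Rightarrow> 'k)"
  then have "indicator W u = (0 :: 'k)" by (simp add: fun_eq_iff)
  with assms show False by simp
qed

lemma simple_lie_algebra_three_units:
  assumes u: "u \<in> units G" "v \<in> units G" "w \<in> units G" "u \<noteq> v" "u \<noteq> w" "v \<noteq> w"
    and no_identity: "\<And>e. S.identity e \<Longrightarrow> e \<notin> S.commutators"
  shows "simple_lie_algebra fscale S.bracket S.commutators"
proof -
  obtain U1 V1 where 1: "openin (gtop G) U1" "openin (gtop G) V1" "u \<in> U1" "v \<in> V1" "U1 \<inter> V1 = {}"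
    by (rule separate_units[OF u(1,2,4)])
  obtain U2 W2 where 2: "openin (gtop G) U2" "openin (gtop G) W2" "u \<in> U2" "w \<in> W2" "U2 \<inter> W2 = {}"
    by (rule separate_units[OF u(1,3,5)])
  obtain V3 W3 where 3: "openin (gtop G) V3" "openin (gtop G) W3" "v \<in> V3" "w \<in> W3" "V3 \<inter> W3 = {}"
    by (rule separate_units[OF u(2,3,6)])
  have opens: "openin (gtop G) (U1 \<inter> U2)" "openin (gtop G) (V1 \<inter> V3)" "openin (gtop G) (W2 \<inter> W3)"
    using 1 2 3 by (simp_all add: openin_Int)
  obtain U where U: "compact_open_units U" "u \<in> U" "U \<subseteq> U1 \<inter> U2"
    by (rule unit_neighbourhood[OF u(1) opens(1)]) (use 1 2 in auto)
  obtain V where V: "compact_open_units V" "v \<in> V" "V \<subseteq> V1 \<inter> V3"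
    by (rule unit_neighbourhood[OF u(2) opens(2)]) (use 1 3 in auto)
  obtain W where W: "compact_open_units W" "w \<in> W" "W \<subseteq> W2 \<inter> W3"
    by (rule unit_neighbourhood[OF u(3) opens(3)]) (use 2 3 in auto)
  have disj: "U \<inter> V = {}" "V \<inter> U = {}" "U \<inter> W = {}" "W \<inter> U = {}" "V \<inter> W = {}" "W \<inter> V = {}"
    using U(3) V(3) W(3) 1(5) 2(5) 3(5) by auto
  have empty: "indicator {} = (0 :: 'g \<Rightarrow> 'k)" by (simp add: fun_eq_iff)
  have "S.orthogonal_idempotents (indicator U) (indicator V) (indicator W)"
    unfolding S.orthogonal_idempotents_def
    using U(1) V(1) W(1) indicator_units_nonzero[OF U(2)] indicator_units_nonzero[OF V(2)]
      indicator_units_nonzero[OF W(2)]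
    by (simp add: indicator_units_in_steinberg_algebra mu_indicators disj empty)
  then show ?thesis using no_identity by (rule S.simple_lie_algebra_three_idempotents)
qed

lemma compact_open_singleton:
  assumes units: "units G = {u, v}"
  shows "compact_open_units {u}"
proof (cases "u = v")
  case True
  have "u \<in> units G" by (simp add: units)
  from unit_neighbourhood[OF this openin_units this]
  obtain W where "compact_open_units W" "u \<in> W" "W \<subseteq> units G" .
  with units True have "W = {u}" by auto
  with \<open>compact_open_units W\<close> show ?thesis by simp
next
  case False
  have uv: "u \<in> units G" "v \<in> units G" by (simp_all add: units)
  obtain U V where UV: "openin (gtop G) U" "openin (gtop G) V" "u \<in> U" "v \<in> V" "U \<inter> V = {}"
    by (rule separate_units[OF uv False])
  obtain W where W: "compact_open_units W" "u \<in> W" "W \<subseteq> U"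
    by (rule unit_neighbourhood[OF uv(1) UV(1,3)])
  with units UV have "W = {u}" by (auto simp: compact_open_units_def)
  with W show ?thesis by simp
qed

lemma simple_lie_algebra_two_units:
  assumes units: "units G = {u, v}" and uv: "u \<noteq> v" and one: "indicator (units G) \<notin> S.commutators"
  shows "simple_lie_algebra fscale S.bracket S.commutators"
proof -
  have u: "compact_open_units {u}" by (rule compact_open_singleton[OF units])
  have v: "compact_open_units {v}" by (rule compact_open_singleton) (use units in auto)
  have W: "compact_open_units (units G)" using compact_open_units_Un[OF u v] by (simp add: units insert_commute)
  have sum: "indicator {u} + indicator {v} = (indicator (units G) :: 'g \<Rightarrow> 'k)"
    using uv by (auto simp: units fun_eq_iff indicator_def)
  have empty: "indicator {} = (0 :: 'g \<Rightarrow> 'k)" by (simp add: fun_eq_iff)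
  have id: "S.identity (indicator (units G))"
    using W by (intro identity_indicator_units) (simp add: compact_open_units_def)
  have disj: "{u} \<inter> {v} = {}" "{v} \<inter> {u} = {}" using uv by auto
  show ?thesis
  proof (rule S.simple_lie_algebra_two_by_two[of "indicator {u}" "indicator {v}"])
    show "S.identity (indicator {u} + indicator {v})" "indicator {u} + indicator {v} \<notin> S.commutators"
      using id one by (simp_all add: sum)
    show "\<exists>c. mu (mu (indicator {u}) a) (indicator {u}) = fscale c (indicator {u})"
      if "a \<in> steinberg_algebra G" for a
      by (rule scalar_corner[OF _ u that]) (simp add: units)
    show "\<exists>c. mu (mu (indicator {v}) a) (indicator {v}) = fscale c (indicator {v})"
      if "a \<in> steinberg_algebra G" for a
      by (rule scalar_corner[OF _ v that]) (simp add: units)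
  qed (use u v indicator_units_nonzero[of u "{u}"] indicator_units_nonzero[of v "{v}"] in
      \<open>simp_all add: indicator_units_in_steinberg_algebra mu_indicators disj empty\<close>)
qed

lemma algebra_isomorphic_one_unit:
  assumes units: "units G = {u}"
  shows "algebra_isomorphic fscale (convolution G) (steinberg_algebra G) (*) (*) (UNIV :: 'k set)"
proof -
  have u: "compact_open_units {u}" by (rule compact_open_singleton[of u u]) (simp add: units)
  define e :: "'g \<Rightarrow> 'k" where "e = indicator {u}"
  have e: "e \<in> steinberg_algebra G" "mu e e = e"
    using u mu_indicators[OF u u] by (simp_all add: e_def indicator_units_in_steinberg_algebra)
  have id: "S.identity e"
    using identity_indicator_units u by (simp add: units e_def compact_open_units_def)
  have scalar: "\<exists>c. a = fscale c e" if a: "a \<in> steinberg_algebra G" for a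
  proof -
    have "\<exists>c. mu (mu e a) e = fscale c e"
      unfolding e_def by (rule scalar_corner[OF _ u a]) (simp add: units)
    with id a show ?thesis by (simp add: S.identity_def)
  qed
  have val: "fscale c e u = c" for c by (simp add: fscale_def e_def)
  show ?thesis
    unfolding algebra_isomorphic_def
  proof (intro exI[of _ "\<lambda>f. f u"] conjI ballI allI)
    show "bij_betw (\<lambda>f. f u) (steinberg_algebra G) (UNIV :: 'k set)"
    proof (rule bij_betw_byWitness[of _ "\<lambda>c. fscale c e"])
      show "\<forall>a\<in>steinberg_algebra G. fscale (a u) e = a" using scalar val by metis
    qed (use e val in auto)
    fix x y :: "'g \<Rightarrow> 'k" assume xy: "x \<in> steinberg_algebra G" "y \<in> steinberg_algebra G"
    then obtain c d where cd: "x = fscale c e" "y = fscale d e" using scalar by blast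
    have "convolution G x y = mu x y" using xy by (simp add: mu_eq)
    also have "\<dots> = fscale (c * d) e" unfolding cd by (simp add: S.mult_simps e(2) mult.commute)
    finally have "convolution G x y = fscale (c * d) e" .
    then show "convolution G x y u = x u * y u" by (simp add: cd val)
  qed (simp_all add: fscale_def)
qed

text \<open>
  A space of two units is compact, so then the identity element exists and the hypothesis on it rules
  out characteristic two.
\<close>
theorem simple_lie_algebra_commutators:
  assumes nontrivial: "\<not> (\<exists>u. units G = {u})"
    and no_identity: "\<And>e. S.identity e \<Longrightarrow> e \<notin> S.commutators"
  shows "simple_lie_algebra fscale S.bracket S.commutators"
proof -
  obtain u where u: "u \<in> units G" using units_nonempty by blast
  with nontrivial have "units G \<noteq> {u}" by blast
  with u obtain v where v: "v \<in> units G" "u \<noteq> v" by blast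
  show ?thesis
  proof (cases "units G = {u, v}")
    case True
    have "compactin (gtop G) (units G)"
      using unitsD(1)[OF u] unitsD(1)[OF v(1)] unfolding True
      by (intro finite_imp_compactin) (auto simp: arrows_def)
    then have "indicator (units G) \<notin> S.commutators"
      by (intro no_identity identity_indicator_units)
    then show ?thesis by (rule simple_lie_algebra_two_units[OF True v(2)])
  next
    case False
    with u v obtain w where "w \<in> units G" "u \<noteq> w" "v \<noteq> w" by blast
    with u v show ?thesis by (intro simple_lie_algebra_three_units[of u v w] no_identity)
  qed
qed

end

text \<open>Convolution preceded by a linear projection onto the Steinberg algebra is such a product.\<close>
lemma (in Hausdorff_ample_groupoid) simple_steinberg_algebraI:
  assumes simple: "simple_algebra fscale (convolution G) (steinberg_algebra G :: ('a \<Rightarrow> 'k::field) set)"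
  obtains mu :: "('a \<Rightarrow> 'k::field) \<Rightarrow> ('a \<Rightarrow> 'k) \<Rightarrow> 'a \<Rightarrow> 'k" where "simple_steinberg_algebra G mu"
proof -
  obtain \<pi> :: "('a \<Rightarrow> 'k) \<Rightarrow> 'a \<Rightarrow> 'k" where \<pi>: "\<And>x. \<pi> x \<in> steinberg_algebra G"
    "\<And>x. x \<in> steinberg_algebra G \<Longrightarrow> \<pi> x = x" "\<And>x y. \<pi> (x + y) = \<pi> x + \<pi> y"
    "\<And>c x. \<pi> (fscale c x) = fscale c (\<pi> x)"
    using vector_space.exists_linear_projection[OF vector_space_fscale subspace_steinberg_algebra] by blast
  define mu where "mu x y = convolution G (\<pi> x) (\<pi> y)" for x y
  have fin: "rng_finite (\<pi> x)" for x by (rule rng_finite_steinberg_algebra[OF \<pi>(1)])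
  have mu_in: "mu x y \<in> steinberg_algebra G" for x y
    unfolding mu_def by (intro convolution_in_steinberg_algebra \<pi>(1))
  have mu_eq: "mu x y = convolution G x y" if "x \<in> steinberg_algebra G" "y \<in> steinberg_algebra G" for x y
    using that by (simp add: mu_def \<pi>(2))
  have "simple_subalgebra fscale mu (steinberg_algebra G)"
  proof (unfold_locales)
    show "mu (mu x y) z = mu x (mu y z)" for x y z
      unfolding mu_def \<pi>(2)[OF convolution_in_steinberg_algebra[OF \<pi>(1) \<pi>(1)]]
      by (rule convolution_assoc[OF fin fin])
    show "mu (x + y) z = mu x z + mu y z" for x y z
      unfolding mu_def \<pi>(3) by (rule convolution_add_left[OF fin fin])
    show "mu x (y + z) = mu x y + mu x z" for x y z
      unfolding mu_def \<pi>(3) by (rule convolution_add_right[OF fin])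
    show "mu (fscale c x) y = fscale c (mu x y)" for c x y
      unfolding mu_def \<pi>(4) by (rule convolution_fscale_left[OF fin])
    show "mu x (fscale c y) = fscale c (mu x y)" for c x y
      unfolding mu_def \<pi>(4) by (rule convolution_fscale_right[OF fin])
    show "fscale.subspace (steinberg_algebra G)" by (rule subspace_steinberg_algebra)
    show "mu x y \<in> steinberg_algebra G" for x y by (rule mu_in)
    show "simple_algebra fscale mu (steinberg_algebra G)"
      by (rule simple_algebra_cong_imp[OF mu_eq[symmetric] simple])
    fix F :: "('a \<Rightarrow> 'k) set" assume F: "finite F" "F \<subseteq> steinberg_algebra G"
    obtain W where W: "compact_open_units W" "\<And>f. f \<in> F \<Longrightarrow> convolution G (indicator W) f = f"
      "\<And>f. f \<in> F \<Longrightarrow> convolution G f (indicator W) = f"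
      using steinberg_algebra_local_units[OF F] by blast
    have e: "(indicator W :: 'a \<Rightarrow> 'k) \<in> steinberg_algebra G" using W(1) by (rule indicator_units_in_steinberg_algebra)
    have "mu (indicator W) (indicator W) = indicator W"
      using W(1) by (simp add: mu_eq[OF e e] convolution_unit_indicators)
    with e W(2,3) F(2) show "\<exists>f\<in>steinberg_algebra G. mu f f = f \<and> (\<forall>x\<in>F. mu f x = x \<and> mu x f = x)"
      by (intro bexI[of _ "indicator W"]) (auto simp: mu_eq subset_iff)
  qed
  then have "simple_steinberg_algebra G mu"
    by (intro simple_steinberg_algebra.intro simple_steinberg_algebra_axioms.intro
        Hausdorff_ample_groupoid_axioms mu_eq mu_in)
  then show thesis by (rule that)
qed

theorem theorem2p9:
  fixes G :: "'g top_groupoid"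
  assumes "Hausdorff_ample_groupoid G"
    and "simple_algebra fscale (convolution G) (steinberg_algebra G :: ('g \<Rightarrow> 'k::field) set)"
  shows "(\<not> compactin (gtop G) (units G) \<longrightarrow>
            simple_lie_algebra fscale (steinberg_bracket G)
              (steinberg_commutators G :: ('g \<Rightarrow> 'k) set)) \<and>
         (compactin (gtop G) (units G) \<and>
          \<not> algebra_isomorphic fscale (convolution G) (steinberg_algebra G :: ('g \<Rightarrow> 'k) set)
               (*) (*) (UNIV :: 'k set) \<longrightarrow>
            (simple_lie_algebra fscale (steinberg_bracket G)
               (steinberg_commutators G :: ('g \<Rightarrow> 'k) set) \<longleftrightarrow>
             (indicator (units G) :: 'g \<Rightarrow> 'k) \<notin> steinberg_commutators G))"
proof -
  interpret Hausdorff_ample_groupoid G by fact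
  obtain mu :: "('g \<Rightarrow> 'k) \<Rightarrow> ('g \<Rightarrow> 'k) \<Rightarrow> 'g \<Rightarrow> 'k" where "simple_steinberg_algebra G mu"
    by (rule simple_steinberg_algebraI[OF assms(2)])
  then interpret simple_steinberg_algebra G mu .
  have singleton_compact: "compactin (gtop G) (units G)" if "units G = {u}" for u
    using compact_open_singleton[of u u] that by (simp add: compact_open_units_def)
  show ?thesis
    unfolding simple_lie_algebra_iff
    unfolding steinberg_commutators_eq
  proof (intro conjI impI)
    assume "\<not> compactin (gtop G) (units G)"
    then show "simple_lie_algebra fscale S.bracket S.commutators"
      using singleton_compact identityD(2) by (intro simple_lie_algebra_commutators) blast+
  next
    assume *: "compactin (gtop G) (units G) \<and> \<not> algebra_isomorphic fscale (convolution G)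
      (steinberg_algebra G :: ('g \<Rightarrow> 'k) set) (*) (*) (UNIV :: 'k set)"
    show "simple_lie_algebra fscale S.bracket S.commutators \<longleftrightarrow> indicator (units G) \<notin> S.commutators"
    proof
      assume "indicator (units G) \<notin> S.commutators"
      then show "simple_lie_algebra fscale S.bracket S.commutators"
        using * algebra_isomorphic_one_unit identityD(1)
        by (intro simple_lie_algebra_commutators) blast+
    next
      assume L: "simple_lie_algebra fscale S.bracket S.commutators"
      obtain u where "u \<in> units G" using units_nonempty by blast
      then have "indicator (units G) \<noteq> (0 :: 'g \<Rightarrow> 'k)" by (rule indicator_units_nonzero)
      then show "indicator (units G) \<notin> S.commutators"
        using S.identity_in_commutators_not_simple[OF identity_indicator_units] * L by blast
    qed
  qed
qed

end
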